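(* Let $N$ be a ground set with $|N|=n$, let $h:2^N\to\mathbb{R}_{\ge 0}$ be monotone submodular, let $\mathcal{M}=(N,\mathcal{I}(\mathcal{M}))$ be a matroid of rank $r\ge 1$, let $\alpha,\delta>0$, $\Delta\in(0,1/2)$, and let $\widehat{\varphi_h}$ be an $(\alpha,\delta,\mathcal{I}(\mathcal{M}))$-approximation of the auxiliary function $\varphi_h$. Let $I=\log_{1+\Delta}\left(\frac{2(1+\alpha)}{1-2(r+1)\alpha}\right)$. Then, with probability at least $1-(I+1)rn\delta$, the output $S_I$ of the noisy local search algorithm $\mathtt{NLS}(\widehat{\varphi_h},\mathcal{I}(\mathcal{M}),\Delta)$ is a $\left(1-\frac{1}{e}\right)\left(1-r\ln(er)\left((2+\Delta)\alpha+\Delta\right)\right)$-approximate solution for the problem $\max_{S\in\mathcal{I}(\mathcal{M})}h(S)$ (i.e. $h(S_I)\ge$ this factor times $\max_{S\in\mathcal{I}(\mathcal{M})}h(S)$), and the algorithm makes at most $(I+1)rn$ calls to $\widehat{\varphi_h}$.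
   Context: Notation: $S+x=S\cup\{x\}$, $S-x=S\setminus\{x\}$. A function $h:2^N\to\mathbb{R}_{\ge0}$ is monotone if $h(A)\le h(B)$ for $A\subseteq B$, and submodular if $h(A+x)-h(A)\ge h(B+x)-h(B)$ for all $A\subseteq B\subseteq N$, $x\in N\setminus B$. A matroid $\mathcal{M}=(N,\mathcal{I}(\mathcal{M}))$ is given by a membership oracle for its independent sets; its rank is the maximum size of an independent set. Auxiliary function: for $s\ge t\ge 0$ let $m_{s,t}=\int_0^1 \frac{e^p}{e-1}p^t(1-p)^{s-t}\,dp$, and $\varphi_h(S)=\sum_{T\subseteq S} m_{|S|-1,|T|-1}\,h(T)$. $(\alpha,\delta,\mathcal{C})$-approximation: for a family $\mathcal{C}\subseteq 2^N$, a randomized function $\widehat{\varphi_h}$ is an $(\alpha,\delta,\mathcal{C})$-approximation of $\varphi_h$ if for every $A\in\mathcal{C}$, $\mathbb{P}\left[|\widehat{\varphi_h}(A)-\varphi_h(A)|>\alpha\max_{S\in\mathcal{C}}\varphi_h(S)\right]\le\delta$. Algorithm $\mathtt{NLS}(\widehat{\varphi_h},\mathcal{I}(\mathcal{M}),\Delta)$: set $I'=\lceil\log_{1+\Delta}(\frac{2(1+\alpha)}{1-2(r+1)\alpha})\rceil$. Greedy phase: $U_0=\varnothing$; for $i=1,\dots,r$ choose $u_i\in\arg\max_{e:\,U_{i-1}+e\in\mathcal{I}(\mathcal{M})}\widehat{\varphi_h}(U_{i-1}+e)$ and set $U_i=U_{i-1}+u_i$; let $S_0=U_r$. Local search phase: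 for $i=0,\dots,I'-1$, scan pairs $x\in S_i$, $y\in N\setminus S_i$; for $S_i'=S_i-x+y$, if $S_i'\in\mathcal{I}(\mathcal{M})$ and $\widehat{\varphi_h}(S_i')\ge(1+\Delta)\widehat{\varphi_h}(S_i)$, set $S_{i+1}=S_i'$ and move to the next $i$. Return the final set $S_I$.
   Formalization: I is the rounded-up log (the algorithm's I'), since with the unrounded log S_I is undefined and the call bound fails; each call to the randomized function uses fresh independent randomness; 1-2(r+1)α>0 is assumed so I is defined; the undefined T=∅ term of φ_h is omitted. *)

theory Defs
  imports "HOL-Probability.Probability"
begin

section \<open>Set functions and matroids\<close>

definition monotone_set_fun :: "'a set \<Rightarrow> ('a set \<Rightarrow> real) \<Rightarrow> bool" where
  "monotone_set_fun N h \<longleftrightarrow> (\<forall>A B. A \<subseteq> B \<and> B \<subseteq> N \<longrightarrow> h A \<le> h B)"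

definition submodular_set_fun :: "'a set \<Rightarrow> ('a set \<Rightarrow> real) \<Rightarrow> bool" where
  "submodular_set_fun N h \<longleftrightarrow>
     (\<forall>A B x. A \<subseteq> B \<and> B \<subseteq> N \<and> x \<in> N - B \<longrightarrow>
        h (insert x A) - h A \<ge> h (insert x B) - h B)"

definition matroid :: "'a set \<Rightarrow> 'a set set \<Rightarrow> bool" where
  "matroid N Ind \<longleftrightarrow>
     finite N \<and> Ind \<subseteq> Pow N \<and> {} \<in> Ind \<and>
     (\<forall>A B. A \<subseteq> B \<and> B \<in> Ind \<longrightarrow> A \<in> Ind) \<and>
     (\<forall>A\<in>Ind. \<forall>B\<in>Ind. card A < card B \<longrightarrow> (\<exists>x\<in>B - A. insert x A \<in> Ind))"

definition matroid_rank :: "'a set set \<Rightarrow> nat" where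
  "matroid_rank Ind = Max (card ` Ind)"


section \<open>The auxiliary function and its randomized approximations\<close>

definition aux_coeff :: "nat \<Rightarrow> nat \<Rightarrow> real" where
  "aux_coeff s t = integral {0..1} (\<lambda>p::real. exp p / (exp 1 - 1) * p ^ t * (1 - p) ^ (s - t))"

text \<open>
  The coefficient of \<open>h T\<close> has second index \<open>|T| - 1\<close>, so it is defined only for nonempty \<open>T\<close>
  (at index \<open>-1\<close> the integral diverges). The empty set therefore contributes nothing to the sum,
  whether or not \<open>h {} = 0\<close>.
\<close>

definition aux_fun :: "('a set \<Rightarrow> real) \<Rightarrow> 'a set \<Rightarrow> real" where
  "aux_fun h S = (\<Sum>T | T \<subseteq> S \<and> T \<noteq> {}. aux_coeff (card S - 1) (card T - 1) * h T)"

text \<open>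
  A randomized function on the subsets of \<open>N\<close> is given by a probability space \<open>R\<close> of seeds and,
  for each set \<open>A\<close>, a real random variable \<open>F A\<close> on \<open>R\<close>: a call at \<open>A\<close> draws a seed \<open>s\<close> from \<open>R\<close>
  and returns \<open>F A s\<close>. Different calls draw independent seeds.
\<close>

definition randomized_fun :: "'a set \<Rightarrow> 'c measure \<Rightarrow> ('a set \<Rightarrow> 'c \<Rightarrow> real) \<Rightarrow> bool" where
  "randomized_fun N R F \<longleftrightarrow> prob_space R \<and> (\<forall>A. A \<subseteq> N \<longrightarrow> F A \<in> borel_measurable R)"

definition approximation_of ::
  "real \<Rightarrow> real \<Rightarrow> 'a set set \<Rightarrow> 'c measure \<Rightarrow> ('a set \<Rightarrow> 'c \<Rightarrow> real) \<Rightarrow> ('a set \<Rightarrow> real) \<Rightarrow> bool" where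
  "approximation_of \<alpha> \<delta> C R F f \<longleftrightarrow>
     (\<forall>A\<in>C. measure R {s \<in> space R. \<bar>F A s - f A\<bar> > \<alpha> * Max (f ` C)} \<le> \<delta>)"


section \<open>Noisy local search\<close>

text \<open>
  The choices the algorithm leaves open are parameters: \<open>cand U\<close> is the order in which the
  candidates for extending \<open>U\<close> are evaluated, \<open>tb U B\<close> selects from the set \<open>B\<close> of maximizers,
  and \<open>pairs S\<close> is the order in which the swaps of \<open>S\<close> are scanned.
\<close>

definition nls_rules ::
  "'a set \<Rightarrow> 'a set set \<Rightarrow> ('a set \<Rightarrow> 'a list) \<Rightarrow> ('a set \<Rightarrow> 'a set \<Rightarrow> 'a)
     \<Rightarrow> ('a set \<Rightarrow> ('a \<times> 'a) list) \<Rightarrow> bool" where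
  "nls_rules N Ind cand tb pairs \<longleftrightarrow>
     (\<forall>U\<in>Ind. distinct (cand U) \<and> set (cand U) = {e \<in> N - U. insert e U \<in> Ind}) \<and>
     (\<forall>U\<in>Ind. \<forall>B. B \<noteq> {} \<and> B \<subseteq> N \<longrightarrow> tb U B \<in> B) \<and>
     (\<forall>S\<in>Ind. distinct (pairs S) \<and> set (pairs S) = S \<times> (N - S))"

text \<open>
  In the following, \<open>\<omega> k\<close> is the seed of the \<open>k\<close>-th call to \<open>F\<close> (counting from 0). A state
  \<open>(S, v, k)\<close> consists of the current set \<open>S\<close>, the value \<open>v\<close> returned by the call at which \<open>S\<close> was
  evaluated, and the number \<open>k\<close> of calls made so far. In the initial state \<open>({}, 0, 0)\<close> the
  value is a dummy that is never read.
\<close>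

definition evaluations ::
  "('a set \<Rightarrow> 'c \<Rightarrow> real) \<Rightarrow> (nat \<Rightarrow> 'c) \<Rightarrow> 'a set \<Rightarrow> nat \<Rightarrow> 'a list \<Rightarrow> ('a \<times> real) list" where
  "evaluations F \<omega> U k es =
     map (\<lambda>j. (es ! j, F (insert (es ! j) U) (\<omega> (k + j)))) [0..<length es]"

definition maximizers :: "('a \<times> real) list \<Rightarrow> 'a set" where
  "maximizers evs = {e. \<exists>v. (e, v) \<in> set evs \<and> (\<forall>(e', v')\<in>set evs. v' \<le> v)}"

fun greedy_step ::
  "('a set \<Rightarrow> 'c \<Rightarrow> real) \<Rightarrow> ('a set \<Rightarrow> 'a list) \<Rightarrow> ('a set \<Rightarrow> 'a set \<Rightarrow> 'a) \<Rightarrow> (nat \<Rightarrow> 'c)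
     \<Rightarrow> 'a set \<times> real \<times> nat \<Rightarrow> 'a set \<times> real \<times> nat" where
  "greedy_step F cand tb \<omega> (U, v, k) =
     (let evs = evaluations F \<omega> U k (cand U);
          u = tb U (maximizers evs)
      in (insert u U, the (map_of evs u), k + length evs))"

definition greedy_phase ::
  "('a set \<Rightarrow> 'c \<Rightarrow> real) \<Rightarrow> ('a set \<Rightarrow> 'a list) \<Rightarrow> ('a set \<Rightarrow> 'a set \<Rightarrow> 'a) \<Rightarrow> (nat \<Rightarrow> 'c)
     \<Rightarrow> nat \<Rightarrow> 'a set \<times> real \<times> nat" where
  "greedy_phase F cand tb \<omega> r = (greedy_step F cand tb \<omega> ^^ r) ({}, 0, 0)"

fun scan_swaps ::
  "('a set \<Rightarrow> 'c \<Rightarrow> real) \<Rightarrow> 'a set set \<Rightarrow> real \<Rightarrow> (nat \<Rightarrow> 'c) \<Rightarrow> 'a set \<Rightarrow> real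
     \<Rightarrow> ('a \<times> 'a) list \<Rightarrow> nat \<Rightarrow> ('a set \<times> real) option \<times> nat" where
  "scan_swaps F Ind \<Delta> \<omega> S v [] k = (None, k)"
| "scan_swaps F Ind \<Delta> \<omega> S v ((x, y) # ps) k =
     (let S' = insert y (S - {x}) in
      if S' \<in> Ind then
        (let v' = F S' (\<omega> k) in
         if v' \<ge> (1 + \<Delta>) * v then (Some (S', v'), Suc k)
         else scan_swaps F Ind \<Delta> \<omega> S v ps (Suc k))
      else scan_swaps F Ind \<Delta> \<omega> S v ps k)"

text \<open>The first argument of type \<open>nat\<close> is the number of remaining iterations.\<close>

fun local_search ::
  "('a set \<Rightarrow> 'c \<Rightarrow> real) \<Rightarrow> 'a set set \<Rightarrow> real \<Rightarrow> ('a set \<Rightarrow> ('a \<times> 'a) list) \<Rightarrow> (nat \<Rightarrow> 'c)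
     \<Rightarrow> nat \<Rightarrow> 'a set \<times> real \<times> nat \<Rightarrow> 'a set \<times> nat" where
  "local_search F Ind \<Delta> pairs \<omega> 0 (S, v, k) = (S, k)"
| "local_search F Ind \<Delta> pairs \<omega> (Suc i) (S, v, k) =
     (case scan_swaps F Ind \<Delta> \<omega> S v (pairs S) k of
        (None, k') \<Rightarrow> (S, k')
      | (Some (S', v'), k') \<Rightarrow> local_search F Ind \<Delta> pairs \<omega> i (S', v', k'))"

definition nls_iterations :: "real \<Rightarrow> real \<Rightarrow> nat \<Rightarrow> nat" where
  "nls_iterations \<alpha> \<Delta> r =
     nat \<lceil>log (1 + \<Delta>) (2 * (1 + \<alpha>) / (1 - 2 * (real r + 1) * \<alpha>))\<rceil>"

definition nls ::
  "('a set \<Rightarrow> 'c \<Rightarrow> real) \<Rightarrow> 'a set set \<Rightarrow> real \<Rightarrow> real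
     \<Rightarrow> ('a set \<Rightarrow> 'a list) \<Rightarrow> ('a set \<Rightarrow> 'a set \<Rightarrow> 'a) \<Rightarrow> ('a set \<Rightarrow> ('a \<times> 'a) list)
     \<Rightarrow> (nat \<Rightarrow> 'c) \<Rightarrow> 'a set \<times> nat" where
  "nls F Ind \<Delta> \<alpha> cand tb pairs \<omega> =
     local_search F Ind \<Delta> pairs \<omega> (nls_iterations \<alpha> \<Delta> (matroid_rank Ind))
       (greedy_phase F cand tb \<omega> (matroid_rank Ind))"

abbreviation nls_output where
  "nls_output F Ind \<Delta> \<alpha> cand tb pairs \<omega> \<equiv> fst (nls F Ind \<Delta> \<alpha> cand tb pairs \<omega>)"

abbreviation nls_calls where
  "nls_calls F Ind \<Delta> \<alpha> cand tb pairs \<omega> \<equiv> snd (nls F Ind \<Delta> \<alpha> cand tb pairs \<omega>)"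

end

theory Submission
  imports Defs
begin

text \<open>
  Resetting \<open>h {}\<close> to 0 changes neither the auxiliary function \<open>\<phi>\<close> nor the optimum, so let \<open>h {} = 0\<close>.
  For a basis \<open>A\<close> and an optimal basis \<open>B\<close>, matched by a bijection of single exchanges, an integration
  by parts of the coefficients of \<open>\<phi>\<close> shows that the losses \<open>\<phi> A - \<phi> (A - s + f s)\<close> sum to at most
  \<open>e / (e - 1) h A - h B\<close>. If no swap gains more than \<open>((2 + \<Delta>) \<alpha> + \<Delta>) max \<phi>\<close>, the guarantee
  follows from \<open>max \<phi> \<le> ln (e r) max h\<close>. As long as all returned values are within \<open>\<alpha> max \<phi>\<close> of
  the truth, this holds for the output: either the last scan rejects every swap, or all iterations
  are used up; in the second case the value, which starts near half of \<open>max \<phi>\<close> after the greedy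
  phase, has grown to \<open>(1 + \<alpha>) max \<phi>\<close>, so that the output maximizes \<open>\<phi>\<close>.
\<close>

section \<open>Coefficients of the auxiliary function\<close>

text \<open>The coefficients have a probabilistic meaning. Draw \<open>p\<close> with density
  \<open>e^p / (e - 1)\<close> on the unit interval and keep each element of \<open>S\<close>
  independently with probability \<open>p\<close>; then \<open>aux_coeff (card S) (card T)\<close>
  is the probability of the outcome \<open>T\<close>. Marginals of \<phi> are expectations of
  marginals of \<open>h\<close> over this random subset, which is why \<phi> inherits monotonicity
  and submodularity. Since the density is its own derivative, integrating by parts returns the same
  family of coefficients plus boundary terms, and these produce the ratio
  \<open>e / (e - 1)\<close>. On the random side the obstacle is adaptivity: which sets are queried
  depends on earlier answers, and a union bound over all sets that might be queried can be far
  weaker than \<open>(I + 1) r n \<delta>\<close>. The probability is therefore followed along the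
  decisions of the algorithm. On an event that fixes all past decisions the next query is a fixed
  set and its seed is fresh, and the branches that follow are disjoint, so their probabilities never
  add up to more than that of the event they split.\<close>

lemma aux_coeff_integrable:
  "(\<lambda>p::real. exp p / (exp 1 - 1) * p ^ t * (1 - p) ^ u) integrable_on {0..1}"
  by (intro integrable_continuous_real continuous_intros) auto

lemma aux_coeff_has_integral:
  "((\<lambda>p::real. exp p / (exp 1 - 1) * p ^ t * (1 - p) ^ (s - t)) has_integral aux_coeff s t) {0..1}"
  unfolding aux_coeff_def using aux_coeff_integrable by (rule integrable_integral)

lemma aux_coeff_nonneg: "0 \<le> aux_coeff s t"
  by (rule has_integral_nonneg[OF aux_coeff_has_integral]) auto

text \<open>The factor \<open>(1 - p) + p = 1\<close>: one further element is either left out or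
  kept, so the weights for \<open>Suc s\<close> elements restrict to those for \<open>s\<close>
  elements.\<close>

lemma aux_coeff_Suc:
  assumes "t \<le> s"
  shows "aux_coeff s t = aux_coeff (Suc s) t + aux_coeff (Suc s) (Suc t)"
proof -
  have "((\<lambda>p::real. exp p / (exp 1 - 1) * p ^ t * (1 - p) ^ (Suc s - t) +
      exp p / (exp 1 - 1) * p ^ Suc t * (1 - p) ^ (Suc s - Suc t))
      has_integral (aux_coeff (Suc s) t + aux_coeff (Suc s) (Suc t))) {0..1}"
    by (intro has_integral_add aux_coeff_has_integral)
  moreover have "exp p / (exp 1 - 1) * p ^ t * (1 - p) ^ (Suc s - t) +
      exp p / (exp 1 - 1) * p ^ Suc t * (1 - p) ^ (Suc s - Suc t) =
      exp p / (exp 1 - 1) * p ^ t * (1 - p) ^ (s - t)" for p :: real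
  proof -
    have "Suc s - t = Suc (s - t)" using assms by simp
    then have "exp p / (exp 1 - 1) * p ^ t * (1 - p) ^ (Suc s - t) +
      exp p / (exp 1 - 1) * p ^ Suc t * (1 - p) ^ (Suc s - Suc t) =
      exp p / (exp 1 - 1) * p ^ t * (1 - p) ^ (s - t) * ((1 - p) + p)"
      by (subst distrib_left) (simp only: power_Suc diff_Suc_Suc mult_ac)
    then show ?thesis by simp
  qed
  ultimately have "((\<lambda>p::real. exp p / (exp 1 - 1) * p ^ t * (1 - p) ^ (s - t))
      has_integral (aux_coeff (Suc s) t + aux_coeff (Suc s) (Suc t))) {0..1}"
    by simp
  then show ?thesis
    using aux_coeff_has_integral has_integral_unique by blast
qed

text \<open>Integrates the derivative of
  \<open>exp p / (exp 1 - 1) * p ^ t * (1 - p) ^ (r - t)\<close>. The boundary value at 1 survives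
  only for \<open>t = r\<close>, that at 0 only for \<open>t = 0\<close>. Where a subtraction in an
  index truncates, the factor in front is 0.\<close>

lemma aux_coeff_by_parts:
  assumes "t \<le> r"
  shows "aux_coeff r t + real t * aux_coeff (r - 1) (t - 1) - (real r - real t) * aux_coeff (r - 1) t
    = ((if t = r then exp 1 else 0) - (if t = 0 then 1 else 0)) / (exp 1 - 1)"
proof -
  define u where "u = r - t"
  have r: "r = t + u" using assms u_def by simp
  let ?c = "exp (1::real) - 1"
  let ?f = "\<lambda>p::real. exp p / ?c * p ^ t * (1 - p) ^ u"
  let ?g = "\<lambda>p::real. exp p / ?c * p ^ t * (1 - p) ^ u
      + real t * (exp p / ?c * p ^ (t - 1) * (1 - p) ^ u)
      - real u * (exp p / ?c * p ^ t * (1 - p) ^ (u - 1))"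
  have "(?g has_integral (?f 1 - ?f 0)) {0..1}"
  proof (rule fundamental_theorem_of_calculus)
    fix p :: real
    have "((\<lambda>p::real. exp p * k * p ^ t * (1 - p) ^ u) has_real_derivative
        exp p * k * p ^ t * (1 - p) ^ u + real t * (exp p * k * p ^ (t - 1) * (1 - p) ^ u)
        - real u * (exp p * k * p ^ t * (1 - p) ^ (u - 1))) (at p within {0..1})" for k
      by (auto intro!: derivative_eq_intros simp: algebra_simps)
    from this[of "inverse ?c"]
    have "(?f has_real_derivative ?g p) (at p within {0..1})"
      by (simp only: divide_inverse)
    then show "(?f has_vector_derivative ?g p) (at p within {0..1})"
      by (simp add: has_real_derivative_iff_has_vector_derivative)
  qed simp
  moreover have "(?g has_integral (aux_coeff r t + real t * aux_coeff (r - 1) (t - 1)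
      - real u * aux_coeff (r - 1) t)) {0..1}"
  proof (intro has_integral_diff has_integral_add)
    show "(?f has_integral aux_coeff r t) {0..1}"
      using aux_coeff_has_integral[of t r] by (simp add: r)
    show "((\<lambda>p. real t * (exp p / ?c * p ^ (t - 1) * (1 - p) ^ u)) has_integral
        real t * aux_coeff (r - 1) (t - 1)) {0..1}"
    proof (cases "t = 0")
      case False
      then have "r - 1 - (t - 1) = u" by (simp add: r)
      then show ?thesis
        using has_integral_mult_right[OF aux_coeff_has_integral[of "t - 1" "r - 1"], of "real t"] by simp
    qed simp
    show "((\<lambda>p. real u * (exp p / ?c * p ^ t * (1 - p) ^ (u - 1))) has_integral
        real u * aux_coeff (r - 1) t) {0..1}"
      using has_integral_mult_right[OF aux_coeff_has_integral[of t "r - 1"], of "real u"] by (simp add: r)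
  qed
  ultimately have "aux_coeff r t + real t * aux_coeff (r - 1) (t - 1) - real u * aux_coeff (r - 1) t
      = ?f 1 - ?f 0"
    using has_integral_unique by blast
  moreover have "?f 1 - ?f 0 = ((if t = r then exp 1 else 0) - (if t = 0 then 1 else 0)) / ?c"
    by (auto simp: r power_0_left diff_divide_distrib)
  ultimately show ?thesis by (simp add: r)
qed

lemma aux_coeff_0_0: "aux_coeff 0 0 = 1"
  using aux_coeff_by_parts[of 0 0] by simp

text \<open>
  The density \<open>e\<^sup>p / (e - 1)\<close> has mean 1 and crosses 1 once, at \<open>p = ln (e - 1)\<close>, from below, so it
  gives a decreasing function a smaller integral than the uniform density does.
\<close>

lemma aux_coeff_0_le: "aux_coeff j 0 \<le> 1 / real (Suc j)"
proof -
  define q where "q = ln (exp (1::real) - 1)"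
  have e2: "exp (1::real) - 1 \<ge> 1" using exp_ge_add_one_self[of "1::real"] by simp
  have eq: "exp q = exp 1 - 1" unfolding q_def using e2 by simp
  have q: "0 \<le> q" "q \<le> 1"
    using e2 ln_le_cancel_iff[of "exp 1 - 1" "exp (1::real)"] unfolding q_def by auto
  have int1: "((\<lambda>p::real. exp p / (exp 1 - 1) * p ^ 0 * (1 - p) ^ (j - 0)) has_integral aux_coeff j 0) {0..1}"
    by (rule aux_coeff_has_integral)
  have int2: "((\<lambda>p::real. exp p / (exp 1 - 1) * p ^ 0 * (1 - p) ^ (0 - 0)) has_integral 1) {0..1}"
    using aux_coeff_has_integral[of 0 0] unfolding aux_coeff_0_0 .
  have int3: "((\<lambda>p::real. (1 - p) ^ j) has_integral (- ((1 - 1) ^ Suc j / real (Suc j)) - (- ((1 - 0) ^ Suc j / real (Suc j))))) {0..1}"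
  proof (rule fundamental_theorem_of_calculus)
    fix p :: real
    have "((\<lambda>p. - ((1 - p) ^ Suc j / real (Suc j))) has_real_derivative (1 - p) ^ j) (at p within {0..1})"
      by (rule derivative_eq_intros refl | simp)+ 
    then show "((\<lambda>p. - ((1 - p) ^ Suc j / real (Suc j))) has_vector_derivative (1 - p) ^ j) (at p within {0..1})"
      by (simp add: has_real_derivative_iff_has_vector_derivative)
  qed simp
  \<comment> \<open>The subtracted multiple of density minus 1 has integral 0. It turns the
    integrand into the product of density minus 1 and \<open>(1 - p) ^ j - (1 - q) ^ j\<close>,
    whose factors have opposite signs on either side of \<open>q\<close>.\<close>
  have "((\<lambda>p::real. (exp p / (exp 1 - 1) * p ^ 0 * (1 - p) ^ (j - 0) - (1 - p) ^ j)
      - (1 - q) ^ j * (exp p / (exp 1 - 1) * p ^ 0 * (1 - p) ^ (0 - 0) - 1)) has_integral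
      ((aux_coeff j 0 - (- ((1 - 1) ^ Suc j / real (Suc j)) - (- ((1 - 0) ^ Suc j / real (Suc j)))))
       - (1 - q) ^ j * (1 - 1))) {0..1}"
    using has_integral_const_real[of "1::real" 0 1]
    by (intro has_integral_diff has_integral_mult_right int1 int2 int3) simp
  then have "(aux_coeff j 0 - (- ((1 - 1) ^ Suc j / real (Suc j)) - (- ((1 - 0) ^ Suc j / real (Suc j)))))
       - (1 - q) ^ j * (1 - 1) \<le> 0"
  proof (rule has_integral_le[OF _ has_integral_0])
    fix p :: real assume p: "p \<in> {0..1}"
    have "(exp p / exp q - 1) * ((1 - p) ^ j - (1 - q) ^ j) \<le> 0"
    proof (cases "p \<le> q")
      case True
      then have "(1 - q) ^ j \<le> (1 - p) ^ j" using q by (intro power_mono) auto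
      then show ?thesis using True by (intro mult_nonpos_nonneg) auto
    next
      case False
      then have "(1 - p) ^ j \<le> (1 - q) ^ j" using p by (intro power_mono) auto
      then show ?thesis using False by (intro mult_nonneg_nonpos) auto
    qed
    then show "(exp p / (exp 1 - 1) * p ^ 0 * (1 - p) ^ (j - 0) - (1 - p) ^ j)
      - (1 - q) ^ j * (exp p / (exp 1 - 1) * p ^ 0 * (1 - p) ^ (0 - 0) - 1) \<le> 0"
      unfolding eq by (simp add: algebra_simps)
  qed
  then show ?thesis by simp
qed


section \<open>The auxiliary function of a submodular function\<close>

lemma card_insert_subset:
  assumes "finite S" "x \<notin> S" "T \<subseteq> S"
  shows "card (insert x T) = Suc (card T)"
  using assms by (meson card_insert_disjoint finite_subset subsetD)

lemma sum_Pow_insert: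
  fixes g :: "'a set \<Rightarrow> real"
  assumes "finite S" "x \<notin> S"
  shows "(\<Sum>T\<in>Pow (insert x S). g T) = (\<Sum>T\<in>Pow S. g T + g (insert x T))"
proof -
  have "Pow S \<inter> insert x ` Pow S = {}" using assms by auto
  moreover have "inj_on (insert x) (Pow S)"
    using assms by (auto simp: inj_on_def)
  ultimately show ?thesis
    using assms by (simp add: Pow_insert sum.union_disjoint sum.reindex sum.distrib)
qed

lemma sum_Pow_remove:
  fixes g :: "'a set \<Rightarrow> real"
  assumes "finite S" "s \<in> S"
  shows "(\<Sum>T\<in>Pow (S - {s}). g (insert s T)) = (\<Sum>T\<in>Pow S. if s \<in> T then g T else 0)"
    and "(\<Sum>T\<in>Pow (S - {s}). g T) = (\<Sum>T\<in>Pow S. if s \<in> T then 0 else g T)"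
proof -
  have S: "Pow S = Pow (insert s (S - {s}))" using assms by (simp add: insert_absorb)
  show "(\<Sum>T\<in>Pow (S - {s}). g (insert s T)) = (\<Sum>T\<in>Pow S. if s \<in> T then g T else 0)"
    unfolding S using assms by (subst sum_Pow_insert) (auto intro!: sum.cong)
  show "(\<Sum>T\<in>Pow (S - {s}). g T) = (\<Sum>T\<in>Pow S. if s \<in> T then 0 else g T)"
    unfolding S using assms by (subst sum_Pow_insert) (auto intro!: sum.cong)
qed

text \<open>The expectation of \<open>g\<close> over the random subset of \<open>S\<close> whose
  distribution the coefficients describe.\<close>

definition coeff_mean :: "'a set \<Rightarrow> ('a set \<Rightarrow> real) \<Rightarrow> real" where
  "coeff_mean S g = (\<Sum>T\<in>Pow S. aux_coeff (card S) (card T) * g T)"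

lemma coeff_mean_mono:
  assumes "\<And>T. T \<subseteq> S \<Longrightarrow> g T \<le> g' T"
  shows "coeff_mean S g \<le> coeff_mean S g'"
  unfolding coeff_mean_def using assms by (intro sum_mono mult_left_mono aux_coeff_nonneg) auto

lemma coeff_mean_insert:
  assumes "finite S" "x \<notin> S"
  shows "coeff_mean (insert x S) g = (\<Sum>T\<in>Pow S. aux_coeff (Suc (card S)) (card T) * g T
    + aux_coeff (Suc (card S)) (Suc (card T)) * g (insert x T))"
  unfolding coeff_mean_def using assms
  by (subst sum_Pow_insert) (auto intro!: sum.cong simp: card_insert_subset[OF assms])

text \<open>By \<open>aux_coeff_Suc\<close>, the random subset of \<open>insert x S\<close> with
  \<open>x\<close> taken out is distributed like that of \<open>S\<close>; what remains is the
  effect of putting \<open>x\<close> in, compared set by set.\<close>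

lemma coeff_mean_insert_le:
  assumes "finite S" "x \<notin> S" and "\<And>T. T \<subseteq> S \<Longrightarrow> g (insert x T) \<le> g T"
  shows "coeff_mean (insert x S) g \<le> coeff_mean S g"
  unfolding coeff_mean_insert[OF assms(1,2)] unfolding coeff_mean_def
proof (rule sum_mono)
  fix T assume "T \<in> Pow S"
  then have T: "T \<subseteq> S" by simp
  then have "card T \<le> card S" using assms(1) by (simp add: card_mono)
  then have "aux_coeff (card S) (card T) * g T = aux_coeff (Suc (card S)) (card T) * g T
      + aux_coeff (Suc (card S)) (Suc (card T)) * g T"
    by (simp add: aux_coeff_Suc[of "card T" "card S"] distrib_right)
  then show "aux_coeff (Suc (card S)) (card T) * g T
    + aux_coeff (Suc (card S)) (Suc (card T)) * g (insert x T) \<le> aux_coeff (card S) (card T) * g T"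
    using assms(3)[OF T] by (simp add: aux_coeff_nonneg mult_left_mono)
qed

lemma coeff_mean_const:
  assumes "finite S"
  shows "coeff_mean S (\<lambda>_. c) = c"
  using assms
proof (induction S rule: finite_induct)
  case empty
  then show ?case by (simp add: coeff_mean_def aux_coeff_0_0)
next
  case (insert x S)
  have "coeff_mean (insert x S) (\<lambda>_. c) = coeff_mean S (\<lambda>_. c)"
    unfolding coeff_mean_insert[OF insert.hyps] unfolding coeff_mean_def
  proof (intro sum.cong refl)
    fix T assume "T \<in> Pow S"
    then have "card T \<le> card S" using insert.hyps by (simp add: card_mono)
    then show "aux_coeff (Suc (card S)) (card T) * c + aux_coeff (Suc (card S)) (Suc (card T)) * c
        = aux_coeff (card S) (card T) * c"
      by (simp add: aux_coeff_Suc[of "card T" "card S"] distrib_right)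
  qed
  then show ?case using insert.IH by simp
qed

lemma coeff_mean_diff: "coeff_mean S (\<lambda>T. g T - g' T) = coeff_mean S g - coeff_mean S g'"
  by (simp add: coeff_mean_def right_diff_distrib sum_subtractf)

lemma coeff_mean_sum: "coeff_mean S (\<lambda>T. \<Sum>i\<in>A. g i T) = (\<Sum>i\<in>A. coeff_mean S (g i))"
  unfolding coeff_mean_def by (simp add: sum_distrib_left) (rule sum.swap)

text \<open>Admits \<open>T = {}\<close>, with a truncated index but the weight
  \<open>h {} = 0\<close>, so that the sum over \<open>Pow\<close> can be split at an
  element.\<close>

lemma aux_fun_Pow:
  assumes "finite S" "h {} = 0"
  shows "aux_fun h S = (\<Sum>T\<in>Pow S. aux_coeff (card S - 1) (card T - 1) * h T)"
  unfolding aux_fun_def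
  by (rule sum.mono_neutral_left) (use assms in auto)

lemma aux_fun_empty [simp]: "aux_fun h {} = 0"
  by (simp add: aux_fun_def)

text \<open>The shift by 1 of both indices in \<open>aux_fun\<close> is made for this: for
  \<open>T \<subseteq> S\<close>, the set \<open>insert x T\<close> receives exactly the weight
  \<open>aux_coeff (card S) (card T)\<close> of the random subset of \<open>S\<close>. Through this
  identity \<open>aux_fun\<close> inherits its properties from the marginals of
  \<open>h\<close>.\<close>

lemma aux_fun_insert:
  assumes "finite S" "x \<notin> S" "h {} = 0"
  shows "aux_fun h (insert x S) = aux_fun h S + coeff_mean S (\<lambda>T. h (insert x T) - h T)"
proof -
  have "aux_fun h (insert x S) = (\<Sum>T\<in>Pow S. aux_coeff (card S) (card T - 1) * h T
      + aux_coeff (card S) (card T) * h (insert x T))"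
    using assms by (simp add: aux_fun_Pow sum_Pow_insert)
      (auto intro!: sum.cong simp: card_insert_subset[OF assms(1,2)])
  also have "\<dots> = (\<Sum>T\<in>Pow S. aux_coeff (card S - 1) (card T - 1) * h T
      + aux_coeff (card S) (card T) * (h (insert x T) - h T))"
  proof (rule sum.cong[OF refl])
    fix T assume "T \<in> Pow S"
    show "aux_coeff (card S) (card T - 1) * h T + aux_coeff (card S) (card T) * h (insert x T)
      = aux_coeff (card S - 1) (card T - 1) * h T
        + aux_coeff (card S) (card T) * (h (insert x T) - h T)"
    proof (cases "T = {}")
      case True
      then show ?thesis using assms by simp
    next
      case False
      have "finite T" using \<open>T \<in> Pow S\<close> assms finite_subset by auto
      then have "0 < card T" "card T \<le> card S"
        using False \<open>T \<in> Pow S\<close> assms by (auto simp: card_gt_0_iff card_mono)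
      then have "aux_coeff (card S - 1) (card T - 1) = aux_coeff (card S) (card T - 1) + aux_coeff (card S) (card T)"
        using aux_coeff_Suc[of "card T - 1" "card S - 1"] by simp
      then show ?thesis by (simp add: algebra_simps)
    qed
  qed
  also have "\<dots> = aux_fun h S + coeff_mean S (\<lambda>T. h (insert x T) - h T)"
    using assms by (simp add: aux_fun_Pow coeff_mean_def sum.distrib)
  finally show ?thesis .
qed

section \<open>Monotonicity, submodularity and size of the auxiliary function\<close>

locale normalized_submodular =
  fixes N :: "'a set" and h :: "'a set \<Rightarrow> real"
  assumes finite_N: "finite N" and h_empty: "h {} = 0"
    and mono_h: "monotone_set_fun N h" and submod_h: "submodular_set_fun N h"
begin

lemma h_mono: "A \<subseteq> B \<Longrightarrow> B \<subseteq> N \<Longrightarrow> h A \<le> h B"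
  using mono_h unfolding monotone_set_fun_def by blast

lemma h_nonneg: "A \<subseteq> N \<Longrightarrow> 0 \<le> h A"
  using h_mono[of "{}" A] h_empty by simp

text \<open>Covers \<open>x \<in> B\<close> as well, where the left side is 0 and monotonicity
  bounds the right side. The case occurs when an exchange fixes an element.\<close>

lemma h_diminishing:
  assumes "A \<subseteq> B" "B \<subseteq> N" "x \<in> N"
  shows "h (insert x B) - h B \<le> h (insert x A) - h A"
proof (cases "x \<in> B")
  case True
  then show ?thesis using h_mono[of A "insert x A"] assms by (auto simp: insert_absorb)
next
  case False
  then show ?thesis using submod_h assms unfolding submodular_set_fun_def by blast
qed

lemma fin: "A \<subseteq> N \<Longrightarrow> finite A"
  using finite_N finite_subset by blast

lemma aux_fun_mono:
  assumes "A \<subseteq> B" "B \<subseteq> N"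
  shows "aux_fun h A \<le> aux_fun h B"
proof -
  have "finite (B - A)" using assms fin by auto
  then show ?thesis using assms
  proof (induction "B - A" arbitrary: B rule: finite_induct)
    case empty
    then show ?case by auto
  next
    case (insert x X)
    then have x: "x \<in> B" "x \<notin> A" by auto
    have "aux_fun h A \<le> aux_fun h (B - {x})"
      using insert by (intro insert.hyps) auto
    also have "\<dots> \<le> aux_fun h (insert x (B - {x}))"
    proof -
      have "0 \<le> coeff_mean (B - {x}) (\<lambda>T. h (insert x T) - h T)"
        unfolding coeff_mean_def using insert.prems x
        by (intro sum_nonneg mult_nonneg_nonneg aux_coeff_nonneg) (auto intro!: h_mono)
      then show ?thesis using insert.prems h_empty fin[of "B - {x}"] by (subst aux_fun_insert) auto
    qed
    finally show ?case using x by (simp add: insert_absorb)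
  qed
qed

text \<open>The marginal of \<open>x\<close> decreases in \<open>T\<close> by submodularity of
  \<open>h\<close>, and enlarging the ground set only adds elements to the random subset, so the
  mean marginal drops.\<close>

lemma aux_fun_diminishing:
  assumes "A \<subseteq> B" "B \<subseteq> N" "x \<in> N"
  shows "aux_fun h (insert x B) - aux_fun h B \<le> aux_fun h (insert x A) - aux_fun h A"
proof (cases "x \<in> B")
  case True
  then show ?thesis using aux_fun_mono[of A "insert x A"] assms by (auto simp: insert_absorb)
next
  case False
  let ?g = "\<lambda>T. h (insert x T) - h T"
  have "finite (B - A)" using assms fin by auto
  then have "coeff_mean B ?g \<le> coeff_mean A ?g" using assms
  proof (induction "B - A" arbitrary: B rule: finite_induct)
    case empty
    then show ?case by (simp add: subset_antisym)
  next
    case (insert y X)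
    then have y: "y \<in> B" "y \<notin> A" by auto
    have "coeff_mean (insert y (B - {y})) ?g \<le> coeff_mean (B - {y}) ?g"
      using insert.prems y fin[of "B - {y}"] by (intro coeff_mean_insert_le h_diminishing) auto
    also have "\<dots> \<le> coeff_mean A ?g"
      using insert y by (intro insert.hyps) auto
    finally show ?case using y by (simp add: insert_absorb)
  qed
  moreover have "x \<notin> A" using False assms by auto
  ultimately show ?thesis
    using False assms h_empty fin[of A] fin[of B] by (simp add: aux_fun_insert)
qed

lemma aux_fun_Un_diminishing:
  assumes "A \<subseteq> B" "B \<subseteq> N" "X \<subseteq> N"
  shows "aux_fun h (B \<union> X) - aux_fun h B \<le> aux_fun h (A \<union> X) - aux_fun h A"
proof -
  have "finite X" using assms fin by blast
  then show ?thesis using assms(3)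
  proof (induction X rule: finite_induct)
    case (insert x X)
    have "aux_fun h (insert x (B \<union> X)) - aux_fun h (B \<union> X)
        \<le> aux_fun h (insert x (A \<union> X)) - aux_fun h (A \<union> X)"
      using insert.prems assms by (intro aux_fun_diminishing) auto
    then show ?case using insert by simp
  qed simp
qed

lemma h_Un_le_sum:
  assumes "T \<subseteq> N" "finite A" "f ` A \<subseteq> N"
  shows "h (T \<union> f ` A) - h T \<le> (\<Sum>a\<in>A. h (insert (f a) T) - h T)"
  using assms(2,3)
proof (induction A rule: finite_induct)
  case (insert a A)
  have "h (insert (f a) (T \<union> f ` A)) - h (T \<union> f ` A) \<le> h (insert (f a) T) - h T"
    using insert.prems assms by (intro h_diminishing) auto
  then show ?case using insert by simp
qed simp

text \<open>Monotonicity replaces each \<open>h T\<close> by \<open>h S\<close>, which leaves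
  \<open>aux_fun\<close> of the indicator of nonempty sets. Its increment from \<open>S\<close> to
  \<open>insert x S\<close> is \<open>aux_coeff (card S) 0\<close>, as adding \<open>x\<close>
  changes the indicator at \<open>T = {}\<close> only; by \<open>aux_coeff_0_le\<close> the
  increments add up to at most a harmonic number.\<close>

lemma aux_fun_le_harm:
  assumes "S \<subseteq> N"
  shows "aux_fun h S \<le> harm (card S) * h S"
proof -
  let ?one = "\<lambda>T::'a set. if T = {} then 0 else 1 :: real"
  have "aux_fun ?one S \<le> harm (card S)"
    using fin[OF assms]
  proof (induction S rule: finite_induct)
    case (insert x S)
    have "coeff_mean S (\<lambda>T. ?one (insert x T) - ?one T)
        = (\<Sum>T\<in>{{}}. aux_coeff (card S) (card T) * (?one (insert x T) - ?one T))"
      unfolding coeff_mean_def using insert.hyps by (intro sum.mono_neutral_right) auto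
    also have "\<dots> \<le> 1 / real (Suc (card S))" using aux_coeff_0_le by simp
    finally show ?case using insert
      by (subst aux_fun_insert) (auto simp: harm_Suc divide_inverse)
  qed (simp add: harm_def)
  then have "aux_fun ?one S * h S \<le> harm (card S) * h S"
    using h_nonneg assms by (simp add: mult_right_mono)
  moreover have "aux_fun h S \<le> aux_fun ?one S * h S"
    unfolding aux_fun_def sum_distrib_right using assms h_mono
    by (intro sum_mono) (auto intro!: mult_left_mono aux_coeff_nonneg)
  ultimately show ?thesis by simp
qed

lemma aux_fun_le:
  assumes "S \<subseteq> N" "card S \<le> r" "1 \<le> r"
  shows "aux_fun h S \<le> ln (exp 1 * real r) * h S"
proof -
  have "harm (card S) \<le> (harm r :: real)"
    using assms by (intro harm_mono) auto
  also have "\<dots> \<le> 1 + ln (real r)"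
    using euler_mascheroni_sequence_decreasing[of 1 r] assms by (simp add: harm_def)
  also have "\<dots> = ln (exp 1 * real r)"
    using assms by (simp add: ln_mult)
  finally have "harm (card S) * h S \<le> ln (exp 1 * real r) * h S"
    using h_nonneg assms by (intro mult_right_mono) auto
  then show ?thesis using aux_fun_le_harm[OF assms(1)] by linarith
qed

section \<open>The summed exchange inequality\<close>

text \<open>After exchanging the sums, \<open>h T\<close> is collected \<open>card T\<close> times
  from removed elements inside \<open>T\<close> and \<open>card S - card T\<close> times,
  negatively, from those outside. This is the combination evaluated in
  \<open>aux_coeff_by_parts\<close>; its boundary terms sit at \<open>T = S\<close>, which gives the
  factor \<open>e / (e - 1)\<close>, and at \<open>T = {}\<close>, where \<open>h\<close>
  vanishes.\<close>

lemma sum_removal_eq: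
  assumes "S \<subseteq> N" "S \<noteq> {}"
  shows "(\<Sum>s\<in>S. aux_fun h S - aux_fun h (S - {s}))
    = exp 1 / (exp 1 - 1) * h S - coeff_mean S h"
proof -
  let ?r = "card S"
  have fS: "finite S" using assms fin by blast
  have r: "?r \<ge> 1" using fS assms by (simp add: Suc_leI card_gt_0_iff)
  have "aux_fun h S - aux_fun h (S - {s})
      = (\<Sum>T\<in>Pow S. (if s \<in> T then aux_coeff (?r - 1) (card T - 1) * h T else 0)
          - (if s \<in> T then 0 else aux_coeff (?r - 1) (card T) * h T))" if s: "s \<in> S" for s
  proof -
    have "aux_fun h S = aux_fun h (insert s (S - {s}))" using s by (simp add: insert_absorb)
    then have "aux_fun h S - aux_fun h (S - {s}) = coeff_mean (S - {s}) (\<lambda>T. h (insert s T) - h T)"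
      using aux_fun_insert[of "S - {s}" s h] h_empty fS by simp
    also have "\<dots> = (\<Sum>T\<in>Pow (S - {s}). aux_coeff (?r - 1) (card (insert s T) - 1) * h (insert s T))
        - (\<Sum>T\<in>Pow (S - {s}). aux_coeff (?r - 1) (card T) * h T)"
      unfolding coeff_mean_diff unfolding coeff_mean_def using s fS
      by (auto intro!: sum.cong arg_cong2[where f="(-)"] simp: card_insert_if finite_subset)
    finally show ?thesis
      unfolding sum_Pow_remove(1)[OF fS s, where g="\<lambda>T. aux_coeff (?r - 1) (card T - 1) * h T"]
        sum_Pow_remove(2)[OF fS s] sum_subtractf .
  qed
  then have "(\<Sum>s\<in>S. aux_fun h S - aux_fun h (S - {s}))
      = (\<Sum>s\<in>S. \<Sum>T\<in>Pow S. (if s \<in> T then aux_coeff (?r - 1) (card T - 1) * h T else 0)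
          - (if s \<in> T then 0 else aux_coeff (?r - 1) (card T) * h T))"
    by simp
  also have "\<dots> = (\<Sum>T\<in>Pow S. \<Sum>s\<in>S. (if s \<in> T then aux_coeff (?r - 1) (card T - 1) * h T else 0)
          - (if s \<in> T then 0 else aux_coeff (?r - 1) (card T) * h T))"
    by (rule sum.swap)
  also have "\<dots> = (\<Sum>T\<in>Pow S. (if T = S then exp 1 / (exp 1 - 1) * h T else 0) - aux_coeff ?r (card T) * h T)"
  proof (rule sum.cong[OF refl])
    fix T assume "T \<in> Pow S"
    then have T: "T \<subseteq> S" "finite T" "card T \<le> ?r" using fS by (auto simp: finite_subset card_mono)
    have "(\<Sum>s\<in>S. (if s \<in> T then aux_coeff (?r - 1) (card T - 1) * h T else 0)
          - (if s \<in> T then 0 else aux_coeff (?r - 1) (card T) * h T))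
        = (\<Sum>s\<in>S. if s \<in> T then aux_coeff (?r - 1) (card T - 1) * h T else 0)
          - (\<Sum>s\<in>S. if s \<in> T then 0 else aux_coeff (?r - 1) (card T) * h T)"
      by (rule sum_subtractf)
    also have "(\<Sum>s\<in>S. if s \<in> T then aux_coeff (?r - 1) (card T - 1) * h T else 0)
        = real (card T) * (aux_coeff (?r - 1) (card T - 1) * h T)"
      using T fS by (simp add: sum.If_cases Int_absorb1)
    also have "(\<Sum>s\<in>S. if s \<in> T then 0 else aux_coeff (?r - 1) (card T) * h T)
        = (real ?r - real (card T)) * (aux_coeff (?r - 1) (card T) * h T)"
      using T fS by (simp add: sum.If_cases card_Diff_subset of_nat_diff flip: Diff_eq)
    also have "real (card T) * (aux_coeff (?r - 1) (card T - 1) * h T)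
        - (real ?r - real (card T)) * (aux_coeff (?r - 1) (card T) * h T)
        = (((if card T = ?r then exp 1 else 0) - (if card T = 0 then 1 else 0)) / (exp 1 - 1)
            - aux_coeff ?r (card T)) * h T"
      unfolding aux_coeff_by_parts[OF T(3), symmetric] by (simp add: algebra_simps)
    also have "\<dots> = (if T = S then exp 1 / (exp 1 - 1) * h T else 0) - aux_coeff ?r (card T) * h T"
    proof (cases "T = {}")
      case True
      then show ?thesis using h_empty by simp
    next
      case False
      then have "card T \<noteq> 0" "card T = ?r \<longleftrightarrow> T = S"
        using T fS card_subset_eq by auto
      then show ?thesis by (simp add: algebra_simps)
    qed
    finally show "(\<Sum>s\<in>S. (if s \<in> T then aux_coeff (?r - 1) (card T - 1) * h T else 0)
          - (if s \<in> T then 0 else aux_coeff (?r - 1) (card T) * h T))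
        = (if T = S then exp 1 / (exp 1 - 1) * h T else 0) - aux_coeff ?r (card T) * h T" .
  qed
  also have "\<dots> = exp 1 / (exp 1 - 1) * h S - coeff_mean S h"
    unfolding sum_subtractf coeff_mean_def using fS by simp
  finally show ?thesis .
qed

text \<open>A swap removes \<open>s\<close> and then adds \<open>f s\<close>. Each addition gains at
  least the mean marginal of \<open>f s\<close> over random subsets \<open>T\<close> of all of
  \<open>S\<close>. For every \<open>T\<close> these marginals add up to at least
  \<open>h B - h T\<close>, and the mean of \<open>h\<close> cancels against the one in
  \<open>sum_removal_eq\<close>.\<close>

lemma sum_swap_le:
  assumes "S \<subseteq> N" "S \<noteq> {}" "bij_betw f S B" "B \<subseteq> N"
    and fixed: "\<And>s. s \<in> S \<Longrightarrow> f s \<in> S \<Longrightarrow> f s = s"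
  shows "(\<Sum>s\<in>S. aux_fun h S - aux_fun h (insert (f s) (S - {s})))
    \<le> exp 1 / (exp 1 - 1) * h S - h B"
proof -
  have fS: "finite S" using assms(1) by (rule fin)
  have fB: "f ` S = B" using assms(3) by (simp add: bij_betw_def)
  have add: "aux_fun h (insert (f s) (S - {s})) - aux_fun h (S - {s})
      \<ge> coeff_mean S (\<lambda>T. h (insert (f s) T) - h T)" if s: "s \<in> S" for s
  proof -
    \<comment> \<open>The role of \<open>fixed\<close>: the added element is new to
      \<open>S - {s}\<close> even if it lies in \<open>S\<close>.\<close>
    have "f s \<notin> S - {s}" using fixed[OF s] by blast
    then have "aux_fun h (insert (f s) (S - {s})) - aux_fun h (S - {s})
        = coeff_mean (S - {s}) (\<lambda>T. h (insert (f s) T) - h T)"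
      using h_empty fS by (simp add: aux_fun_insert)
    moreover have "coeff_mean (insert s (S - {s})) (\<lambda>T. h (insert (f s) T) - h T)
        \<le> coeff_mean (S - {s}) (\<lambda>T. h (insert (f s) T) - h T)"
      using assms(1,4) s fB fS by (intro coeff_mean_insert_le h_diminishing) auto
    ultimately show ?thesis using s by (simp add: insert_absorb)
  qed
  have "h B - coeff_mean S h = coeff_mean S (\<lambda>T. h B - h T)"
    using fS by (simp add: coeff_mean_diff coeff_mean_const)
  also have "\<dots> \<le> coeff_mean S (\<lambda>T. \<Sum>s\<in>S. h (insert (f s) T) - h T)"
  proof (rule coeff_mean_mono)
    fix T assume T: "T \<subseteq> S"
    have "h B \<le> h (T \<union> f ` S)" using T assms(1,4) fB by (intro h_mono) auto
    then show "h B - h T \<le> (\<Sum>s\<in>S. h (insert (f s) T) - h T)"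
      using h_Un_le_sum[OF subset_trans[OF T assms(1)] fS, of f] assms(4) unfolding fB by linarith
  qed
  also have "\<dots> = (\<Sum>s\<in>S. coeff_mean S (\<lambda>T. h (insert (f s) T) - h T))"
    by (rule coeff_mean_sum)
  also have "\<dots> \<le> (\<Sum>s\<in>S. aux_fun h (insert (f s) (S - {s})) - aux_fun h (S - {s}))"
    using add by (intro sum_mono) auto
  finally have "h B - coeff_mean S h
      \<le> (\<Sum>s\<in>S. aux_fun h (insert (f s) (S - {s})) - aux_fun h (S - {s}))" .
  moreover have "(\<Sum>s\<in>S. aux_fun h S - aux_fun h (insert (f s) (S - {s})))
      = (\<Sum>s\<in>S. aux_fun h S - aux_fun h (S - {s}))
        - (\<Sum>s\<in>S. aux_fun h (insert (f s) (S - {s})) - aux_fun h (S - {s}))"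
    by (simp add: sum_subtractf)
  ultimately show ?thesis using sum_removal_eq[OF assms(1,2)] by linarith
qed

end


section \<open>Exchange properties of matroids\<close>

locale finite_matroid =
  fixes N :: "'a set" and Ind :: "'a set set"
  assumes matroid: "matroid N Ind"
begin

lemma finite_ground: "finite N"
  and Ind_subset: "A \<in> Ind \<Longrightarrow> A \<subseteq> N"
  and empty_Ind: "{} \<in> Ind"
  and Ind_mono: "A \<subseteq> B \<Longrightarrow> B \<in> Ind \<Longrightarrow> A \<in> Ind"
  and augment: "A \<in> Ind \<Longrightarrow> B \<in> Ind \<Longrightarrow> card A < card B \<Longrightarrow> \<exists>x\<in>B - A. insert x A \<in> Ind"
  using matroid unfolding matroid_def by blast+

lemma Ind_finite: "A \<in> Ind \<Longrightarrow> finite A"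
  using Ind_subset finite_ground finite_subset by blast

lemma finite_Ind: "finite Ind"
  using Ind_subset finite_ground by (intro finite_subset[of Ind "Pow N"]) auto

lemma card_le_rank: "A \<in> Ind \<Longrightarrow> card A \<le> matroid_rank Ind"
  unfolding matroid_rank_def using finite_Ind by simp

lemma ex_basis: "\<exists>B\<in>Ind. card B = matroid_rank Ind"
proof -
  have "Max (card ` Ind) \<in> card ` Ind" using finite_Ind empty_Ind by (intro Max_in) auto
  then show ?thesis unfolding matroid_rank_def by auto
qed

lemma augment_to_card:
  assumes "A \<in> Ind" "B \<in> Ind" "card A \<le> card B"
  shows "\<exists>D\<in>Ind. A \<subseteq> D \<and> D \<subseteq> A \<union> B \<and> card D = card B"
  using assms
proof (induction "card B - card A" arbitrary: A)
  case 0
  then show ?case by (intro bexI[of _ A]) auto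
next
  case (Suc d)
  have "card A < card B" using Suc.hyps(2) by simp
  then obtain x where x: "x \<in> B - A" "insert x A \<in> Ind" using augment[of A B] Suc.prems by blast
  have "card (insert x A) = Suc (card A)" using x Suc.prems Ind_finite by auto
  then obtain D where "D \<in> Ind" "insert x A \<subseteq> D" "D \<subseteq> insert x A \<union> B" "card D = card B"
    using Suc.hyps(1)[of "insert x A"] Suc.hyps(2) Suc.prems(2) x(2) \<open>card A < card B\<close>
    by (metis Suc_leI diff_Suc_1 diff_Suc_eq_diff_pred diff_diff_left plus_1_eq_Suc add.commute)
  then show ?case using x by (intro bexI[of _ D]) auto
qed

text \<open>
  The element \<open>b\<close> is taken from a smallest \<open>C \<subseteq> B\<close> for which \<open>insert s C\<close> is dependent, that is, from
  the fundamental circuit of \<open>s\<close> with respect to \<open>B\<close>.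
\<close>

lemma symmetric_exchange:
  assumes "S \<in> Ind" "B \<in> Ind" "card S = matroid_rank Ind" "card B = matroid_rank Ind"
    and s: "s \<in> S - B"
  shows "\<exists>b\<in>B - S. insert b (S - {s}) \<in> Ind \<and> insert s (B - {b}) \<in> Ind"
proof -
  let ?r = "matroid_rank Ind"
  have fin: "finite S" "finite B" using assms Ind_finite by auto
  have "insert s B \<notin> Ind"
    using card_le_rank[of "insert s B"] assms fin by auto
  then obtain C where C: "C \<subseteq> B" "insert s C \<notin> Ind"
    and min: "\<And>D. D \<subseteq> B \<Longrightarrow> insert s D \<notin> Ind \<Longrightarrow> card C \<le> card D"
    using ex_has_least_nat[of "\<lambda>C. C \<subseteq> B \<and> insert s C \<notin> Ind" B card] by auto
  have fC: "finite C" using C fin finite_subset by blast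
  have CI: "C \<in> Ind" using C assms Ind_mono by blast
  have "\<exists>b\<in>C - S. insert b (S - {s}) \<in> Ind"
  proof -
    \<comment> \<open>A basis between \<open>C\<close> and \<open>C \<union> S\<close> misses
      \<open>s\<close>, as \<open>insert s C\<close> is dependent. Augmenting \<open>S - {s}\<close>
      from it must therefore use an element of \<open>C - S\<close>.\<close>
    obtain D where D: "D \<in> Ind" "C \<subseteq> D" "D \<subseteq> C \<union> S" "card D = ?r"
      using augment_to_card[of C S] assms CI card_le_rank by auto
    have "s \<notin> D" using D C Ind_mono[of "insert s C" D] by auto
    moreover have "card (S - {s}) < ?r" using assms fin s card_Diff1_less[of S s] by auto
    moreover have "S - {s} \<in> Ind" using Ind_mono[OF Diff_subset assms(1)] .
    ultimately obtain b where "b \<in> D - (S - {s})" "insert b (S - {s}) \<in> Ind"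
      using augment[of "S - {s}" D] D by auto
    then show ?thesis using D \<open>s \<notin> D\<close> by auto
  qed
  then obtain b where b: "b \<in> C" "b \<notin> S" "insert b (S - {s}) \<in> Ind" by auto
  have "insert s (C - {b}) \<in> Ind"
    using min[of "C - {b}"] C(1) card_Diff1_less[OF fC b(1)] by (meson Diff_subset leD subset_trans)
  then obtain D where D: "D \<in> Ind" "insert s (C - {b}) \<subseteq> D" "D \<subseteq> insert s (C - {b}) \<union> B" "card D = ?r"
    using augment_to_card[of "insert s (C - {b})" B] assms card_le_rank by metis
  \<comment> \<open>\<open>D\<close> contains \<open>s\<close> and the rest of \<open>C\<close>, so
    \<open>b\<close> would complete the dependent set \<open>insert s C\<close>. This leaves room
    only for \<open>insert s (B - {b})\<close>.\<close>
  have "b \<notin> D" using D C b Ind_mono[of "insert s C" D] by auto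
  then have "D \<subseteq> insert s (B - {b})" using D C by auto
  moreover have "card (insert s (B - {b})) = card D"
    using D(4) assms(4) fin s b(1) C(1) card_Suc_Diff1[of B b] by auto
  ultimately have "D = insert s (B - {b})" using fin by (intro card_subset_eq) auto
  then show ?thesis using D b C by auto
qed

text \<open>Induction on \<open>card (S - B)\<close>: a symmetric exchange moves \<open>B\<close>
  one step towards \<open>S\<close>. The bijection onto the new basis fixes \<open>s\<close>, and
  redirecting \<open>s\<close> to \<open>b\<close> gives one onto \<open>B\<close>. One half of the
  exchange makes the new pair feasible, the other keeps the induction among bases.\<close>

lemma basis_bijection:
  assumes "S \<in> Ind" "B \<in> Ind" "card S = matroid_rank Ind" "card B = matroid_rank Ind"
  shows "\<exists>f. bij_betw f S B \<and> (\<forall>s\<in>S. insert (f s) (S - {s}) \<in> Ind) \<and> (\<forall>s\<in>S. f s \<in> S \<longrightarrow> f s = s)"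
  using assms
proof (induction "card (S - B)" arbitrary: B)
  case 0
  have fin: "finite S" "finite B" using 0 Ind_finite by auto
  then have "S \<subseteq> B" using 0 by auto
  then have "S = B" using 0 fin card_subset_eq by metis
  then show ?case using 0 by (intro exI[of _ id]) (auto simp: insert_absorb bij_betw_def)
next
  case (Suc d)
  have fin: "finite S" "finite B" using Suc Ind_finite by auto
  have "S - B \<noteq> {}" using Suc.hyps(2) by (metis card.empty nat.distinct(1))
  then obtain s where s: "s \<in> S - B" by blast
  obtain b where b: "b \<in> B - S" "insert b (S - {s}) \<in> Ind" "insert s (B - {b}) \<in> Ind"
    using symmetric_exchange[OF Suc.prems s] by auto
  let ?B = "insert s (B - {b})"
  have "S - ?B = (S - B) - {s}" using b by auto
  then have "d = card (S - ?B)" using Suc.hyps(2) s fin by simp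
  moreover have "card ?B = card B"
    using fin s b(1) card_Suc_Diff1[of B b] by auto
  ultimately obtain f where f: "bij_betw f S ?B" "\<And>s. s \<in> S \<Longrightarrow> insert (f s) (S - {s}) \<in> Ind"
    "\<And>s. s \<in> S \<Longrightarrow> f s \<in> S \<Longrightarrow> f s = s"
    using Suc.hyps(1)[of ?B] Suc.prems b by auto
  have im: "f ` S = ?B" and inj: "inj_on f S" using f(1) by (auto simp: bij_betw_def)
  \<comment> \<open>The preimage of \<open>s\<close> is mapped into \<open>S\<close>, hence fixed,
    hence it is \<open>s\<close> itself.\<close>
  obtain x where x: "x \<in> S" "f x = s" using im by (metis imageE insertI1)
  then have fs: "f s = s" using f(3)[of x] s by auto
  let ?g = "f(s := b)"
  have "?g ` S = B"
  proof -
    have "f ` (S - {s}) = B - {b}"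
      using inj im fs s by (subst inj_on_image_set_diff[of f S]) auto
    moreover have "?g ` S = insert b (f ` (S - {s}))" using s by auto
    ultimately show ?thesis using b by auto
  qed
  moreover have "inj_on ?g S"
    using \<open>?g ` S = B\<close> fin Suc.prems by (intro eq_card_imp_inj_on) auto
  ultimately have "bij_betw ?g S B" by (simp add: bij_betw_def)
  moreover have "insert (?g t) (S - {t}) \<in> Ind" if "t \<in> S" for t
    using f(2)[OF that] b(2) by auto
  moreover have "?g t = t" if "t \<in> S" "?g t \<in> S" for t
    using f(3)[OF that(1)] that b(1) by (auto split: if_splits)
  ultimately show ?case by blast
qed

end


section \<open>Events determined by the first seeds\<close>

context sequence_space
begin

text \<open>An event of the past before call \<open>k\<close>, described by dependence on the first
  \<open>k\<close> seeds instead of a sub-sigma-algebra, so that the condition is checked sequence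
  by sequence.\<close>

definition adapted :: "nat \<Rightarrow> (nat \<Rightarrow> 'a) set \<Rightarrow> bool" where
  "adapted k E \<longleftrightarrow> E \<in> sets S \<and>
     (\<forall>\<omega>\<in>space S. \<forall>\<omega>'\<in>space S. (\<forall>j<k. \<omega> j = \<omega>' j) \<longrightarrow> \<omega> \<in> E \<longleftrightarrow> \<omega>' \<in> E)"

definition adapted_var :: "nat \<Rightarrow> ((nat \<Rightarrow> 'a) \<Rightarrow> real) \<Rightarrow> bool" where
  "adapted_var k v \<longleftrightarrow> v \<in> borel_measurable S \<and>
     (\<forall>\<omega>\<in>space S. \<forall>\<omega>'\<in>space S. (\<forall>j<k. \<omega> j = \<omega>' j) \<longrightarrow> v \<omega> = v \<omega>')"

lemma adapted_mono: "adapted k E \<Longrightarrow> k \<le> l \<Longrightarrow> adapted l E"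
  unfolding adapted_def by (meson order_less_le_trans)

lemma adapted_var_mono: "adapted_var k v \<Longrightarrow> k \<le> l \<Longrightarrow> adapted_var l v"
  unfolding adapted_var_def by (meson order_less_le_trans)

lemma adapted_space: "adapted k (space S)"
  unfolding adapted_def by auto

lemma adapted_var_component:
  assumes "f \<in> borel_measurable M" "j < k"
  shows "adapted_var k (\<lambda>\<omega>. f (\<omega> j))"
  unfolding adapted_var_def
proof
  show "(\<lambda>\<omega>. f (\<omega> j)) \<in> borel_measurable S"
    using assms(1) by measurable
qed (use assms in auto)

text \<open>Splicing the first \<open>k\<close> seeds of one sequence onto a second, independent one
  preserves the product measure. The event pulls back to a rectangle: \<open>E\<close> sees only the
  first sequence, and seed \<open>k\<close> is seed 0 of the second.\<close>

lemma measure_adapted_Int_component: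
  assumes E: "adapted k E" and C: "C \<in> sets M"
  shows "prob {\<omega>\<in>E. \<omega> k \<in> C} = prob E * measure M C"
proof -
  have ES: "E \<in> sets S" using E by (simp add: adapted_def)
  then have sub: "E \<subseteq> space S" by (rule sets.sets_into_space)
  let ?C = "{\<omega>\<in>space S. \<omega> 0 \<in> C}"
  have C0: "?C \<in> sets S" using C by measurable
  have Ck: "{\<omega>\<in>space S. \<omega> k \<in> C} \<in> sets S" using C by measurable
  have set: "{\<omega>\<in>E. \<omega> k \<in> C} = E \<inter> {\<omega>\<in>space S. \<omega> k \<in> C}" using sub by auto
  then have EC: "{\<omega>\<in>E. \<omega> k \<in> C} \<in> sets S" using ES Ck by auto
  have comb: "(\<lambda>(\<omega>, \<omega>'). comb_seq k \<omega> \<omega>') \<in> measurable (S \<Otimes>\<^sub>M S) S"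
    by (rule measurable_comb_seq)
  have "(\<lambda>(\<omega>, \<omega>'). comb_seq k \<omega> \<omega>') -` {\<omega>\<in>E. \<omega> k \<in> C} \<inter> space (S \<Otimes>\<^sub>M S) = E \<times> ?C"
  proof (rule set_eqI, clarify)
    fix \<omega> \<omega>' :: "nat \<Rightarrow> 'a"
    show "(\<omega>, \<omega>') \<in> (\<lambda>(\<omega>, \<omega>'). comb_seq k \<omega> \<omega>') -` {\<omega>\<in>E. \<omega> k \<in> C} \<inter> space (S \<Otimes>\<^sub>M S)
        \<longleftrightarrow> (\<omega>, \<omega>') \<in> E \<times> ?C"
    proof (cases "\<omega> \<in> space S \<and> \<omega>' \<in> space S")
      case True
      then have c: "comb_seq k \<omega> \<omega>' \<in> space S"
        using measurable_space[OF comb, of "(\<omega>, \<omega>')"] by (simp add: space_pair_measure)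
      have "comb_seq k \<omega> \<omega>' k = \<omega>' 0" using comb_seq_add[of k \<omega> \<omega>' 0] by simp
      moreover have "comb_seq k \<omega> \<omega>' \<in> E \<longleftrightarrow> \<omega> \<in> E"
        using E True c comb_seq_less[of _ k \<omega> \<omega>'] unfolding adapted_def by blast
      ultimately show ?thesis using True by (auto simp: space_pair_measure)
    next
      case False
      then show ?thesis using sub by (auto simp: space_pair_measure)
    qed
  qed
  then have "emeasure S {\<omega>\<in>E. \<omega> k \<in> C} = emeasure (S \<Otimes>\<^sub>M S) (E \<times> ?C)"
    using emeasure_distr[OF comb EC] by (simp add: PiM_comb_seq)
  also have "\<dots> = emeasure S E * emeasure S ?C"
    using ES C0 by (rule P.emeasure_pair_measure_Times)
  also have "emeasure S ?C = emeasure M C"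
    using C by (intro emeasure_PiM_Collect_single) auto
  finally have "measure S {\<omega>\<in>E. \<omega> k \<in> C} = measure S E * measure M C"
    by (simp add: measure_def enn2real_mult)
  then show ?thesis .
qed

lemma adapted_Collect:
  assumes "adapted k E" and [measurable]: "Measurable.pred S P"
    and "\<And>\<omega> \<omega>'. \<omega> \<in> space S \<Longrightarrow> \<omega>' \<in> space S \<Longrightarrow> (\<forall>j<k. \<omega> j = \<omega>' j) \<Longrightarrow> P \<omega> = P \<omega>'"
  shows "adapted k {\<omega>\<in>E. P \<omega>}"
proof -
  have E: "E \<in> sets S" using assms(1) by (simp add: adapted_def)
  then have "{\<omega>\<in>E. P \<omega>} = E \<inter> {\<omega>\<in>space S. P \<omega>}" using sets.sets_into_space by auto
  moreover have "{\<omega>\<in>space S. P \<omega>} \<in> sets S" by measurable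
  ultimately have "{\<omega>\<in>E. P \<omega>} \<in> sets S" using E by auto
  moreover have "\<omega> \<in> {\<omega>\<in>E. P \<omega>} \<longleftrightarrow> \<omega>' \<in> {\<omega>\<in>E. P \<omega>}"
    if "\<omega> \<in> space S" "\<omega>' \<in> space S" "\<forall>j<k. \<omega> j = \<omega>' j" for \<omega> \<omega>'
    using assms(1) assms(3)[OF that] that unfolding adapted_def by blast
  ultimately show ?thesis unfolding adapted_def by blast
qed

lemma pred_threshold:
  fixes v w :: "(nat \<Rightarrow> 'a) \<Rightarrow> real" and a b c :: real
  assumes v: "v \<in> borel_measurable S" and w: "w \<in> borel_measurable S"
  shows "Measurable.pred S (\<lambda>\<omega>. \<bar>w \<omega> - a\<bar> \<le> b \<and> c * v \<omega> \<le> w \<omega>)"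
    and "Measurable.pred S (\<lambda>\<omega>. \<bar>w \<omega> - a\<bar> \<le> b \<and> w \<omega> < c * v \<omega>)"
  unfolding pred_def
  by (intro sets.sets_Collect_conj borel_measurable_le borel_measurable_less borel_measurable_abs
      borel_measurable_diff borel_measurable_times borel_measurable_const v w)+

lemma adapted_sets: "adapted k E \<Longrightarrow> E \<in> sets S"
  by (simp add: adapted_def)

lemma adapted_subset_space: "adapted k E \<Longrightarrow> E \<subseteq> space S"
  using adapted_sets sets.sets_into_space by blast

lemma adapted_var_measurable: "adapted_var k v \<Longrightarrow> v \<in> borel_measurable S"
  by (simp add: adapted_var_def)

lemma adapted_varD:
  "adapted_var k v \<Longrightarrow> \<omega> \<in> space S \<Longrightarrow> \<omega>' \<in> space S \<Longrightarrow> (\<forall>j<k. \<omega> j = \<omega>' j) \<Longrightarrow> v \<omega> = v \<omega>'"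
  unfolding adapted_var_def by blast

lemma sets_Collect_subset: "A \<in> sets S \<Longrightarrow> {\<omega>\<in>space S. P \<omega>} \<in> sets S \<Longrightarrow> {\<omega>\<in>A. P \<omega>} \<in> sets S"
proof -
  assume A: "A \<in> sets S" and "{\<omega>\<in>space S. P \<omega>} \<in> sets S"
  then have "A \<inter> {\<omega>\<in>space S. P \<omega>} \<in> sets S" by auto
  moreover have "A \<inter> {\<omega>\<in>space S. P \<omega>} = {\<omega>\<in>A. P \<omega>}" using A sets.sets_into_space by auto
  ultimately show ?thesis by simp
qed

end


section \<open>Noisy local search\<close>

locale noisy_search = normalized_submodular N h + finite_matroid N Ind + sequence_space R
  for N :: "'a set" and h :: "'a set \<Rightarrow> real" and Ind :: "'a set set" and R :: "'c measure" +
  fixes F :: "'a set \<Rightarrow> 'c \<Rightarrow> real" and \<alpha> \<delta> \<Delta> :: real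
    and cand :: "'a set \<Rightarrow> 'a list" and tb :: "'a set \<Rightarrow> 'a set \<Rightarrow> 'a"
    and pairs :: "'a set \<Rightarrow> ('a \<times> 'a) list"
  assumes rank_ge: "1 \<le> matroid_rank Ind"
    and \<alpha>_pos: "0 < \<alpha>" and \<delta>_pos: "0 < \<delta>" and \<Delta>_pos: "0 < \<Delta>"
    and \<alpha>_small: "0 < 1 - 2 * (real (matroid_rank Ind) + 1) * \<alpha>"
    and F_measurable: "A \<subseteq> N \<Longrightarrow> F A \<in> borel_measurable R"
    and approx: "approximation_of \<alpha> \<delta> Ind R F (aux_fun h)"
    and rules: "nls_rules N Ind cand tb pairs"
begin

abbreviation "\<phi> \<equiv> aux_fun h"
abbreviation "r \<equiv> matroid_rank Ind"
abbreviation "n \<equiv> card N"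

definition \<phi>_max :: real where "\<phi>_max = Max (\<phi> ` Ind)"

definition accurate :: "'a set \<Rightarrow> real \<Rightarrow> bool" where
  "accurate A v \<longleftrightarrow> \<bar>v - \<phi> A\<bar> \<le> \<alpha> * \<phi>_max"

text \<open>Bounds the gain in \<open>\<phi>\<close> of a swap that is rejected on accurate values;
  the constant is derived in \<open>rejected_swap\<close>.\<close>

definition swap_slack :: real where "swap_slack = ((2 + \<Delta>) * \<alpha> + \<Delta>) * \<phi>_max"

definition ok :: "'a set \<Rightarrow> bool" where
  "ok A \<longleftrightarrow> (1 - 1 / exp 1) * (1 - real r * ln (exp 1 * real r) * ((2 + \<Delta>) * \<alpha> + \<Delta>))
     * Max (h ` Ind) \<le> h A"

section \<open>From bounded swap gains to the approximation guarantee\<close>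

lemma \<phi>_le_max: "A \<in> Ind \<Longrightarrow> \<phi> A \<le> \<phi>_max"
  unfolding \<phi>_max_def using finite_Ind by (intro Max_ge) auto

lemma \<phi>_max_nonneg: "0 \<le> \<phi>_max"
  using \<phi>_le_max[OF empty_Ind] by simp

lemma swap_slack_nonneg: "0 \<le> swap_slack"
  unfolding swap_slack_def using \<alpha>_pos \<Delta>_pos \<phi>_max_nonneg by (intro mult_nonneg_nonneg) auto

lemma extend_to_basis:
  assumes "A \<in> Ind"
  shows "\<exists>B\<in>Ind. A \<subseteq> B \<and> card B = r"
proof -
  obtain B where "B \<in> Ind" "card B = r" using ex_basis by auto
  then show ?thesis using augment_to_card[OF assms, of B] card_le_rank[OF assms] by auto
qed

lemma h_le_max: "A \<in> Ind \<Longrightarrow> h A \<le> Max (h ` Ind)"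
  using finite_Ind by (intro Max_ge) auto

lemma \<phi>_max_le: "\<phi>_max \<le> ln (exp 1 * real r) * Max (h ` Ind)"
proof -
  have "\<phi>_max \<in> \<phi> ` Ind"
    unfolding \<phi>_max_def using finite_Ind empty_Ind by (intro Max_in) auto
  then obtain A where A: "A \<in> Ind" "\<phi>_max = \<phi> A" by auto
  have "\<phi> A \<le> ln (exp 1 * real r) * h A"
    using A Ind_subset card_le_rank rank_ge by (intro aux_fun_le) auto
  also have "\<dots> \<le> ln (exp 1 * real r) * Max (h ` Ind)"
    using rank_ge h_le_max[OF A(1)] by (intro mult_left_mono) (auto simp: ln_mult)
  finally show ?thesis using A by simp
qed

lemma local_optimum_ok:
  assumes A: "A \<in> Ind" "card A = r"
    and opt: "\<And>x y. x \<in> A \<Longrightarrow> y \<in> N - A \<Longrightarrow> insert y (A - {x}) \<in> Ind \<Longrightarrow>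
      \<phi> (insert y (A - {x})) \<le> \<phi> A + swap_slack"
  shows "ok A"
proof -
  let ?H = "Max (h ` Ind)"
  have "?H \<in> h ` Ind"
    using finite_Ind empty_Ind by (intro Max_in) auto
  then obtain B' where B': "B' \<in> Ind" "h B' = ?H" by auto
  \<comment> \<open>An optimal set need not be a basis, but the bijection of exchanges matches
    bases. Extending the set does not lower \<open>h\<close>.\<close>
  obtain B where B: "B \<in> Ind" "B' \<subseteq> B" "card B = r" using extend_to_basis B' by blast
  have hB: "?H \<le> h B" using h_mono[OF B(2)] Ind_subset B B' by auto
  obtain f where f: "bij_betw f A B" "\<forall>s\<in>A. insert (f s) (A - {s}) \<in> Ind"
      "\<forall>s\<in>A. f s \<in> A \<longrightarrow> f s = s"
    using basis_bijection[OF A(1) B(1) A(2) B(3)] by blast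
  have "A \<noteq> {}" using A rank_ge by auto
  then have "(\<Sum>s\<in>A. \<phi> A - \<phi> (insert (f s) (A - {s}))) \<le> exp 1 / (exp 1 - 1) * h A - h B"
    using Ind_subset A B f by (intro sum_swap_le) blast+
  moreover have "(\<Sum>s\<in>A. \<phi> A - \<phi> (insert (f s) (A - {s}))) \<ge> (\<Sum>s\<in>A. - swap_slack)"
  proof (rule sum_mono)
    fix s assume s: "s \<in> A"
    show "- swap_slack \<le> \<phi> A - \<phi> (insert (f s) (A - {s}))"
    proof (cases "f s \<in> A")
      case True
      then have "f s = s" using f s by blast
      then show ?thesis using s swap_slack_nonneg by (simp add: insert_absorb)
    next
      case False
      moreover have "f s \<in> N" using f(1) s B(1) Ind_subset bij_betwE by blast
      ultimately show ?thesis using opt[OF s, of "f s"] f(2) s by auto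
    qed
  qed
  ultimately have "?H - real r * swap_slack \<le> exp 1 / (exp 1 - 1) * h A"
    using hB A by simp
  moreover have "real r * swap_slack
      \<le> real r * ln (exp 1 * real r) * ((2 + \<Delta>) * \<alpha> + \<Delta>) * ?H"
  proof -
    have "real r * ((2 + \<Delta>) * \<alpha> + \<Delta>) * \<phi>_max
        \<le> real r * ((2 + \<Delta>) * \<alpha> + \<Delta>) * (ln (exp 1 * real r) * ?H)"
      using \<alpha>_pos \<Delta>_pos by (intro mult_left_mono \<phi>_max_le) auto
    then show ?thesis unfolding swap_slack_def by (simp only: mult_ac)
  qed
  ultimately have le: "(1 - real r * ln (exp 1 * real r) * ((2 + \<Delta>) * \<alpha> + \<Delta>)) * ?H
      \<le> exp 1 / (exp 1 - 1) * h A"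
    by (simp add: left_diff_distrib)
  have e: "exp (1::real) > 1" by simp
  have "(1 - 1 / exp 1) * ((1 - real r * ln (exp 1 * real r) * ((2 + \<Delta>) * \<alpha> + \<Delta>)) * ?H)
      \<le> (1 - 1 / exp 1) * (exp 1 / (exp 1 - 1) * h A)"
    using le by (rule mult_left_mono) simp
  also have "\<dots> = ((1 - 1 / exp 1) * (exp 1 / (exp 1 - 1))) * h A" by simp
  also have "(1 - 1 / exp 1) * (exp 1 / (exp 1 - 1)) = (1::real)"
    using e by (simp add: divide_simps del: one_less_exp_iff)
  finally show ?thesis unfolding ok_def by (simp only: mult.assoc mult_1)
qed

lemma \<phi>_maximal_ok:
  assumes "A \<in> Ind" "card A = r" "\<phi>_max \<le> \<phi> A"
  shows "ok A"
  using assms \<phi>_le_max swap_slack_nonneg by (intro local_optimum_ok) (auto intro: order_trans add_increasing2)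

text \<open>The error bound enters once through \<open>v'\<close> and \<open>1 + \<Delta>\<close>
  times through the stored \<open>v\<close>, which gives \<open>(2 + \<Delta>) * \<alpha>\<close>.
  The summand \<open>\<Delta>\<close> comes from the required growth
  \<open>\<Delta> * \<phi> A\<close>, which is at most \<open>\<Delta> * \<phi>_max\<close>.\<close>

lemma rejected_swap:
  assumes "A \<in> Ind" "accurate A v" "accurate A' v'" "v' < (1 + \<Delta>) * v"
  shows "\<phi> A' \<le> \<phi> A + swap_slack"
proof -
  have "\<phi> A' \<le> v' + \<alpha> * \<phi>_max" using assms(3) unfolding accurate_def by linarith
  also have "\<dots> \<le> (1 + \<Delta>) * v + \<alpha> * \<phi>_max" using assms(4) by simp
  also have "\<dots> \<le> (1 + \<Delta>) * (\<phi> A + \<alpha> * \<phi>_max) + \<alpha> * \<phi>_max"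
    using assms(2) \<Delta>_pos unfolding accurate_def by (intro add_right_mono mult_left_mono) linarith+
  also have "\<dots> = \<phi> A + \<Delta> * \<phi> A + (2 + \<Delta>) * \<alpha> * \<phi>_max" by (simp add: algebra_simps)
  also have "\<dots> \<le> \<phi> A + \<Delta> * \<phi>_max + (2 + \<Delta>) * \<alpha> * \<phi>_max"
    using \<phi>_le_max[OF assms(1)] \<Delta>_pos by simp
  finally show ?thesis unfolding swap_slack_def by (simp add: algebra_simps)
qed

text \<open>
  With exact values, a greedy set satisfies \<open>\<phi> (U \<union> B) \<le> 2 \<phi> U\<close> for every independent \<open>B\<close> of the same size;
  each noisy step adds at most twice the error bound.
\<close>

definition greedy_inv :: "'a set \<Rightarrow> bool" where
  "greedy_inv U \<longleftrightarrow> (\<forall>B\<in>Ind. card B = card U \<longrightarrow> \<phi> (U \<union> B) \<le> 2 * \<phi> U + 2 * real (card U) * \<alpha> * \<phi>_max)"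

lemma greedy_inv_empty: "greedy_inv {}"
  unfolding greedy_inv_def using Ind_finite by auto

text \<open>Drop from \<open>B\<close> an element \<open>b\<close> by which \<open>U\<close> can be
  extended. The rest of \<open>B\<close> gains no more on top of \<open>insert u U\<close> than on
  top of \<open>U\<close>, where the invariant applies, and \<open>b\<close> gains at most what
  \<open>u\<close> gained plus twice the error bound.\<close>

lemma greedy_inv_insert:
  assumes U: "U \<in> Ind" "greedy_inv U" and u: "u \<notin> U" "insert u U \<in> Ind"
    and best: "\<And>e. e \<in> N - U \<Longrightarrow> insert e U \<in> Ind \<Longrightarrow> \<phi> (insert e U) \<le> \<phi> (insert u U) + 2 * \<alpha> * \<phi>_max"
  shows "greedy_inv (insert u U)"
  unfolding greedy_inv_def
proof (intro ballI impI)
  fix B assume B: "B \<in> Ind" "card B = card (insert u U)"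
  have fin: "finite U" "finite B" using U B Ind_finite by auto
  then have cB: "card B = Suc (card U)" using B u by simp
  then obtain b where b: "b \<in> B - U" "insert b U \<in> Ind" using augment[OF U(1) B(1)] by auto
  let ?B = "B - {b}" and ?U = "insert u U"
  have sub: "U \<subseteq> N" "?U \<subseteq> N" "B \<subseteq> N" using U u B Ind_subset by auto
  have "?B \<in> Ind" using Ind_mono[OF Diff_subset B(1)] .
  moreover have "card ?B = card U" using b cB fin by simp
  ultimately have inv: "\<phi> (U \<union> ?B) \<le> 2 * \<phi> U + 2 * real (card U) * \<alpha> * \<phi>_max"
    using U(2) unfolding greedy_inv_def by blast
  have "\<phi> (?U \<union> ?B) - \<phi> ?U \<le> \<phi> (U \<union> ?B) - \<phi> U"
    using sub by (intro aux_fun_Un_diminishing) auto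
  moreover have "\<phi> (insert b (?U \<union> ?B)) - \<phi> (?U \<union> ?B) \<le> \<phi> (insert b U) - \<phi> U"
    using sub b by (intro aux_fun_diminishing) auto
  moreover have "insert b (?U \<union> ?B) = ?U \<union> B" using b by auto
  moreover have "\<phi> (insert b U) \<le> \<phi> ?U + 2 * \<alpha> * \<phi>_max"
    using best[of b] b sub by auto
  ultimately have "\<phi> (?U \<union> B) \<le> 2 * \<phi> ?U + 2 * real (card U) * \<alpha> * \<phi>_max + 2 * \<alpha> * \<phi>_max"
    using inv by simp
  also have "\<dots> = 2 * \<phi> ?U + 2 * real (card ?U) * \<alpha> * \<phi>_max"
    using fin u by (simp add: algebra_simps)
  finally show "\<phi> (?U \<union> B) \<le> 2 * \<phi> ?U + 2 * real (card ?U) * \<alpha> * \<phi>_max" .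
qed

text \<open>Origin of \<open>2 * (r + 1)\<close>: the \<open>r\<close> greedy steps cost
  \<open>2 * r * \<alpha>\<close>, and passing from \<open>2 * \<phi> U\<close> to twice the
  returned \<open>v\<close> costs another \<open>2 * \<alpha>\<close>.\<close>

lemma greedy_value:
  assumes "U \<in> Ind" "card U = r" "greedy_inv U" "accurate U v"
  shows "(1 - 2 * (real r + 1) * \<alpha>) / 2 * \<phi>_max \<le> v"
proof -
  have "\<phi>_max \<in> \<phi> ` Ind"
    unfolding \<phi>_max_def using finite_Ind empty_Ind by (intro Max_in) auto
  then obtain B' where B': "B' \<in> Ind" "\<phi> B' = \<phi>_max" by auto
  obtain B where B: "B \<in> Ind" "B' \<subseteq> B" "card B = r" using extend_to_basis B' by blast
  have "\<phi>_max \<le> \<phi> (U \<union> B)"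
    unfolding B'(2)[symmetric] using B Ind_subset assms(1) by (intro aux_fun_mono) auto
  also have "\<dots> \<le> 2 * \<phi> U + 2 * real r * \<alpha> * \<phi>_max"
    using assms B unfolding greedy_inv_def by auto
  finally show ?thesis using assms(4) unfolding accurate_def by (simp add: field_simps abs_le_iff)
qed

section \<open>Number of iterations\<close>

abbreviation "K \<equiv> nls_iterations \<alpha> \<Delta> r"

lemma iterations_suffice: "2 * (1 + \<alpha>) / (1 - 2 * (real r + 1) * \<alpha>) \<le> (1 + \<Delta>) ^ K"
proof -
  let ?x = "2 * (1 + \<alpha>) / (1 - 2 * (real r + 1) * \<alpha>)"
  have x: "0 < ?x" using \<alpha>_pos \<alpha>_small by (intro divide_pos_pos) auto
  have "log (1 + \<Delta>) ?x \<le> real K"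
    unfolding nls_iterations_def by linarith
  then have "?x \<le> (1 + \<Delta>) powr real K"
    using x \<Delta>_pos by (simp only: log_le_iff)
  then show ?thesis using \<Delta>_pos by (simp add: powr_realpow)
qed

text \<open>The argument of the logarithm is the target \<open>(1 + \<alpha>) * \<phi>_max\<close>
  divided by the lower bound in \<open>greedy_value\<close>; from the target on, accuracy alone
  implies \<open>\<phi>_max \<le> \<phi> A\<close>. The form is that of a budget: each accepted swap
  turns one factor \<open>1 + \<Delta>\<close> into growth of the value.\<close>

lemma greedy_value_iterated:
  assumes "U \<in> Ind" "card U = r" "greedy_inv U" "accurate U v"
  shows "(1 + \<alpha>) * \<phi>_max \<le> (1 + \<Delta>) ^ K * v"
proof -
  let ?d = "1 - 2 * (real r + 1) * \<alpha>"
  have "(1 + \<alpha>) * \<phi>_max = 2 * (1 + \<alpha>) / ?d * (?d / 2 * \<phi>_max)"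
    using \<alpha>_small by simp
  also have "\<dots> \<le> (1 + \<Delta>) ^ K * (?d / 2 * \<phi>_max)"
    using iterations_suffice \<phi>_max_nonneg \<alpha>_small by (intro mult_right_mono) auto
  also have "\<dots> \<le> (1 + \<Delta>) ^ K * v"
    using greedy_value[OF assms] \<Delta>_pos by (intro mult_left_mono) auto
  finally show ?thesis .
qed

text \<open>
  The rest of an iteration that still has to scan \<open>ps\<close>, followed by \<open>i\<close> further iterations. It makes
  one induction over the scan serve both the measurability and the probability bound.
\<close>

definition resume ::
  "(nat \<Rightarrow> 'c) \<Rightarrow> nat \<Rightarrow> 'a set \<Rightarrow> real \<Rightarrow> ('a \<times> 'a) list \<Rightarrow> nat \<Rightarrow> 'a set \<times> nat" where
  "resume \<omega> i A v ps k =
     (case scan_swaps F Ind \<Delta> \<omega> A v ps k of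
        (None, k') \<Rightarrow> (A, k')
      | (Some (A', v'), k') \<Rightarrow> local_search F Ind \<Delta> pairs \<omega> i (A', v', k'))"

lemma local_search_Suc:
  "local_search F Ind \<Delta> pairs \<omega> (Suc i) (A, v, k) = resume \<omega> i A v (pairs A) k"
  by (simp add: resume_def)

lemma resume_Nil: "resume \<omega> i A v [] k = (A, k)"
  by (simp add: resume_def)

lemma resume_Cons:
  "resume \<omega> i A v ((x, y) # ps) k =
     (let A' = insert y (A - {x}) in
      if A' \<in> Ind then
        if (1 + \<Delta>) * v \<le> F A' (\<omega> k) then local_search F Ind \<Delta> pairs \<omega> i (A', F A' (\<omega> k), Suc k)
        else resume \<omega> i A v ps (Suc k)
      else resume \<omega> i A v ps k)"
  by (simp add: resume_def Let_def)

lemma F_component_measurable: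
  "A \<in> Ind \<Longrightarrow> (\<lambda>\<omega>. F A (\<omega> k)) \<in> borel_measurable S"
  by (rule measurable_compose[OF measurable_component_singleton[of k] F_measurable[OF Ind_subset]]) auto

lemma pairs_set: "A \<in> Ind \<Longrightarrow> set (pairs A) = A \<times> (N - A)"
  and pairs_distinct: "A \<in> Ind \<Longrightarrow> distinct (pairs A)"
  and cand_set: "A \<in> Ind \<Longrightarrow> set (cand A) = {e \<in> N - A. insert e A \<in> Ind}"
  and cand_distinct: "A \<in> Ind \<Longrightarrow> distinct (cand A)"
  and tb_in: "A \<in> Ind \<Longrightarrow> B \<noteq> {} \<Longrightarrow> B \<subseteq> N \<Longrightarrow> tb A B \<in> B"
  using rules unfolding nls_rules_def by blast+

lemma length_pairs:
  assumes "A \<in> Ind"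
  shows "length (pairs A) \<le> r * n"
proof -
  have "length (pairs A) = card (A \<times> (N - A))"
    using distinct_card[OF pairs_distinct[OF assms]] pairs_set[OF assms] by simp
  also have "\<dots> \<le> r * n"
    using card_le_rank[OF assms] finite_ground by (simp add: card_cartesian_product mult_le_mono card_mono)
  finally show ?thesis .
qed

lemma length_cand:
  assumes "A \<in> Ind"
  shows "length (cand A) \<le> n"
proof -
  have "length (cand A) = card (set (cand A))"
    using distinct_card[OF cand_distinct[OF assms]] by simp
  also have "\<dots> \<le> n"
    using finite_ground cand_set[OF assms] by (intro card_mono) auto
  finally show ?thesis .
qed

lemma cand_nonempty:
  assumes "A \<in> Ind" "card A < r"
  shows "cand A \<noteq> []"
proof -
  obtain B where "B \<in> Ind" "card B = r" using ex_basis by auto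
  then obtain x where "x \<in> B - A" "insert x A \<in> Ind" using augment[of A B] assms by auto
  then have "x \<in> set (cand A)" using cand_set[OF assms(1)] Ind_subset by auto
  then show ?thesis by auto
qed

lemma card_swap:
  assumes "A \<in> Ind" "x \<in> A" "y \<notin> A"
  shows "card (insert y (A - {x})) = card A"
  using assms Ind_finite[of A] card_Suc_Diff1[of A x] by auto

section \<open>Measurability of the local search\<close>

text \<open>Sets and counters stay fixed and only the value \<open>v\<close> is a random variable:
  the scan is unfolded swap by swap, and every branching compares two real random variables. With
  \<open>Q\<close> arbitrary, no measurable structure on the sets themselves has to be
  chosen.\<close>

lemma resume_measurable_step:
  assumes "\<And>A v k. A \<in> Ind \<Longrightarrow> v \<in> borel_measurable S \<Longrightarrow>
      {\<omega>\<in>space S. Q (fst (local_search F Ind \<Delta> pairs \<omega> i (A, v \<omega>, k)))} \<in> sets S"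
    and "v \<in> borel_measurable S"
  shows "{\<omega>\<in>space S. Q (fst (resume \<omega> i A (v \<omega>) ps k))} \<in> sets S"
proof (induction ps arbitrary: k)
  case Nil
  then show ?case by (simp add: resume_Nil)
next
  case (Cons p ps)
  obtain x y where p: "p = (x, y)" by (cases p)
  let ?A = "insert y (A - {x})"
  show ?case
  proof (cases "?A \<in> Ind")
    case True
    have split: "{\<omega>\<in>space S. (1 + \<Delta>) * v \<omega> \<le> w \<omega>} \<in> sets S"
      "{\<omega>\<in>space S. w \<omega> < (1 + \<Delta>) * v \<omega>} \<in> sets S" if [measurable]: "w \<in> borel_measurable S" for w
      using assms(2) by measurable
    have "{\<omega>\<in>space S. (1 + \<Delta>) * v \<omega> \<le> F ?A (\<omega> k)}
        \<inter> {\<omega>\<in>space S. Q (fst (local_search F Ind \<Delta> pairs \<omega> i (?A, F ?A (\<omega> k), Suc k)))}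
        \<union> {\<omega>\<in>space S. F ?A (\<omega> k) < (1 + \<Delta>) * v \<omega>}
        \<inter> {\<omega>\<in>space S. Q (fst (resume \<omega> i A (v \<omega>) ps (Suc k)))} \<in> sets S" (is "?X \<in> _")
      by (intro sets.Un sets.Int Cons.IH split F_component_measurable True assms(1))
    also have "?X = {\<omega>\<in>space S. Q (fst (resume \<omega> i A (v \<omega>) (p # ps) k))}"
      using True by (auto simp: p resume_Cons Let_def)
    finally show ?thesis .
  next
    case False
    then show ?thesis using Cons.IH by (simp add: p resume_Cons)
  qed
qed

lemma local_search_measurable:
  assumes "A \<in> Ind" "v \<in> borel_measurable S"
  shows "{\<omega>\<in>space S. Q (fst (local_search F Ind \<Delta> pairs \<omega> i (A, v \<omega>, k)))} \<in> sets S"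
  using assms
proof (induction i arbitrary: A v k)
  case (Suc i)
  then show ?case unfolding local_search_Suc by (intro resume_measurable_step)
qed simp

lemma resume_measurable:
  assumes "v \<in> borel_measurable S"
  shows "{\<omega>\<in>space S. Q (fst (resume \<omega> i A (v \<omega>) ps k))} \<in> sets S"
  by (intro resume_measurable_step local_search_measurable assms)

section \<open>Failure probability of the local search\<close>

text \<open>\<open>A\<close> is a fixed set and the seed of call \<open>k\<close> is independent of
  \<open>E\<close>, so the guarantee for a single call is multiplied by
  \<open>prob E\<close>.\<close>

lemma prob_inaccurate:
  assumes E: "adapted k E" and A: "A \<in> Ind"
  shows "{\<omega>\<in>E. \<not> accurate A (F A (\<omega> k))} \<in> sets S"
    and "prob {\<omega>\<in>E. \<not> accurate A (F A (\<omega> k))} \<le> prob E * \<delta>"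
proof -
  let ?C = "{s \<in> space R. \<bar>F A s - \<phi> A\<bar> > \<alpha> * \<phi>_max}"
  have [measurable]: "F A \<in> borel_measurable R" using A Ind_subset F_measurable by blast
  have C: "?C \<in> sets R" by measurable
  have le: "measure R ?C \<le> \<delta>"
    using approx A unfolding approximation_of_def \<phi>_max_def by blast
  have "\<omega> k \<in> space R" if "\<omega> \<in> E" for \<omega>
    using adapted_subset_space[OF E] that by (auto simp: space_PiM)
  then have eq: "{\<omega>\<in>E. \<not> accurate A (F A (\<omega> k))} = {\<omega>\<in>E. \<omega> k \<in> ?C}"
    unfolding accurate_def by auto
  have "{\<omega>\<in>space S. \<omega> k \<in> ?C} \<in> sets S" using C by measurable
  then show "{\<omega>\<in>E. \<not> accurate A (F A (\<omega> k))} \<in> sets S"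
    unfolding eq by (rule sets_Collect_subset[OF adapted_sets[OF E]])
  show "prob {\<omega>\<in>E. \<not> accurate A (F A (\<omega> k))} \<le> prob E * \<delta>"
    unfolding eq measure_adapted_Int_component[OF E C] using le by (intro mult_left_mono) auto
qed

text \<open>
  The union bound over adaptively chosen queries: conditioning on an event \<open>E\<close> of the past, the next
  call fails with probability at most \<open>\<delta>\<close>, and on success \<open>E\<close> splits into two events of the new past,
  according to whether the swap is accepted.
\<close>

lemma resume_fail_prob:
  assumes A: "A \<in> Ind" "card A = r"
    and local: "\<And>A v k E. A \<in> Ind \<Longrightarrow> card A = r \<Longrightarrow> adapted k E \<Longrightarrow> adapted_var k v \<Longrightarrow>
      (\<And>\<omega>. \<omega> \<in> E \<Longrightarrow> accurate A (v \<omega>) \<and> (1 + \<alpha>) * \<phi>_max \<le> (1 + \<Delta>) ^ i * v \<omega>) \<Longrightarrow>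
      prob {\<omega>\<in>E. \<not> ok (fst (local_search F Ind \<Delta> pairs \<omega> i (A, v \<omega>, k)))} \<le> prob E * c"
    and c: "0 \<le> c"
    and "adapted k E" "adapted_var k v" "set ps \<subseteq> A \<times> (N - A)"
    and "\<And>\<omega>. \<omega> \<in> E \<Longrightarrow> accurate A (v \<omega>) \<and> (1 + \<alpha>) * \<phi>_max \<le> (1 + \<Delta>) ^ Suc i * v \<omega>"
    and "\<And>\<omega> x y. \<omega> \<in> E \<Longrightarrow> x \<in> A \<Longrightarrow> y \<in> N - A \<Longrightarrow> (x, y) \<notin> set ps \<Longrightarrow>
      insert y (A - {x}) \<in> Ind \<Longrightarrow> \<phi> (insert y (A - {x})) \<le> \<phi> A + swap_slack"
  shows "prob {\<omega>\<in>E. \<not> ok (fst (resume \<omega> i A (v \<omega>) ps k))} \<le> prob E * (real (length ps) * \<delta> + c)"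
  using assms(5-)
proof (induction ps arbitrary: k E)
  case Nil
  \<comment> \<open>With nothing left to scan, every feasible swap is known to gain at most
    \<open>swap_slack\<close>, so no outcome in \<open>E\<close> fails.\<close>
  have "ok A" if "\<omega> \<in> E" for \<omega>
    using Nil.prems(5)[OF that] by (intro local_optimum_ok A) auto
  then have "{\<omega>\<in>E. \<not> ok (fst (resume \<omega> i A (v \<omega>) [] k))} = {}" by (auto simp: resume_Nil)
  then show ?case using c by (simp only: measure_empty) simp
next
  case (Cons p ps)
  obtain x y where p: "p = (x, y)" by (cases p)
  have xy: "x \<in> A" "y \<in> N - A" using Cons.prems(3) by (auto simp: p)
  let ?A = "insert y (A - {x})"
  have ps: "set ps \<subseteq> A \<times> (N - A)" using Cons.prems(3) by simp
  show ?case
  proof (cases "?A \<in> Ind")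
    case False
    \<comment> \<open>A swap to a dependent set makes no call, so \<open>k\<close> and
      \<open>E\<close> stay the same and the bound has one \<open>\<delta>\<close> to spare.\<close>
    have "prob {\<omega>\<in>E. \<not> ok (fst (resume \<omega> i A (v \<omega>) ps k))} \<le> prob E * (real (length ps) * \<delta> + c)"
    proof (rule Cons.IH[OF Cons.prems(1,2) ps Cons.prems(4)])
      fix \<omega> x' y' assume "\<omega> \<in> E" "x' \<in> A" "y' \<in> N - A" "(x', y') \<notin> set ps" and I: "insert y' (A - {x'}) \<in> Ind"
      moreover have "(x', y') \<noteq> p" using I False p by auto
      ultimately show "\<phi> (insert y' (A - {x'})) \<le> \<phi> A + swap_slack"
        by (intro Cons.prems(5)) auto
    qed
    also have "\<dots> \<le> prob E * (real (length (p # ps)) * \<delta> + c)"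
      using \<delta>_pos by (intro mult_left_mono) auto
    finally show ?thesis using False by (simp add: p resume_Cons)
  next
    case True
    let ?w = "\<lambda>\<omega>. F ?A (\<omega> k)"
    have w: "adapted_var (Suc k) ?w"
      using True Ind_subset by (intro adapted_var_component F_measurable) auto
    have E: "adapted (Suc k) E" and v: "adapted_var (Suc k) v"
      using Cons.prems adapted_mono adapted_var_mono le_Suc_eq by blast+
    have pred: "Measurable.pred S (\<lambda>\<omega>. accurate ?A (?w \<omega>) \<and> (1 + \<Delta>) * v \<omega> \<le> ?w \<omega>)"
      "Measurable.pred S (\<lambda>\<omega>. accurate ?A (?w \<omega>) \<and> ?w \<omega> < (1 + \<Delta>) * v \<omega>)"
      unfolding accurate_def
      by (intro pred_threshold adapted_var_measurable[OF v] adapted_var_measurable[OF w])+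
    define E1 where "E1 = {\<omega>\<in>E. accurate ?A (?w \<omega>) \<and> (1 + \<Delta>) * v \<omega> \<le> ?w \<omega>}"
    define E2 where "E2 = {\<omega>\<in>E. accurate ?A (?w \<omega>) \<and> ?w \<omega> < (1 + \<Delta>) * v \<omega>}"
    define X where "X = {\<omega>\<in>E. \<not> accurate ?A (?w \<omega>)}"
    define X1 where "X1 = {\<omega>\<in>E1. \<not> ok (fst (local_search F Ind \<Delta> pairs \<omega> i (?A, ?w \<omega>, Suc k)))}"
    define X2 where "X2 = {\<omega>\<in>E2. \<not> ok (fst (resume \<omega> i A (v \<omega>) ps (Suc k)))}"
    have E1: "adapted (Suc k) E1" unfolding E1_def
    proof (rule adapted_Collect[OF E pred(1)])
      fix \<omega> \<omega>' assume "\<omega> \<in> space S" "\<omega>' \<in> space S" "\<forall>j<Suc k. \<omega> j = \<omega>' j"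
      then have "v \<omega> = v \<omega>'" "\<omega> k = \<omega>' k" using adapted_varD[OF v] by blast+
      then show "(accurate ?A (?w \<omega>) \<and> (1 + \<Delta>) * v \<omega> \<le> ?w \<omega>) = (accurate ?A (?w \<omega>') \<and> (1 + \<Delta>) * v \<omega>' \<le> ?w \<omega>')" by simp
    qed
    have E2: "adapted (Suc k) E2" unfolding E2_def
    proof (rule adapted_Collect[OF E pred(2)])
      fix \<omega> \<omega>' assume "\<omega> \<in> space S" "\<omega>' \<in> space S" "\<forall>j<Suc k. \<omega> j = \<omega>' j"
      then have "v \<omega> = v \<omega>'" "\<omega> k = \<omega>' k" using adapted_varD[OF v] by blast+
      then show "(accurate ?A (?w \<omega>) \<and> ?w \<omega> < (1 + \<Delta>) * v \<omega>) = (accurate ?A (?w \<omega>') \<and> ?w \<omega>' < (1 + \<Delta>) * v \<omega>')" by simp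
    qed
    have X: "X \<in> sets S" "prob X \<le> prob E * \<delta>"
      unfolding X_def using prob_inaccurate[OF Cons.prems(1) True] by auto
    have X1: "prob X1 \<le> prob E1 * c"
      unfolding X1_def
    proof (rule local[OF True _ E1 w])
      show "card ?A = r" using card_swap A xy by simp
      fix \<omega> assume "\<omega> \<in> E1"
      then have *: "accurate ?A (?w \<omega>)" "(1 + \<Delta>) * v \<omega> \<le> ?w \<omega>" "\<omega> \<in> E" by (auto simp: E1_def)
      \<comment> \<open>Accepting uses up one of the remaining factors \<open>1 + \<Delta>\<close>,
        and the new value makes up for it.\<close>
      have "(1 + \<alpha>) * \<phi>_max \<le> (1 + \<Delta>) ^ i * ((1 + \<Delta>) * v \<omega>)"
        using Cons.prems(4)[OF *(3)] by (simp add: mult_ac)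
      also have "\<dots> \<le> (1 + \<Delta>) ^ i * ?w \<omega>"
        using *(2) \<Delta>_pos by (intro mult_left_mono) auto
      finally show "accurate ?A (?w \<omega>) \<and> (1 + \<alpha>) * \<phi>_max \<le> (1 + \<Delta>) ^ i * ?w \<omega>"
        using * by blast
    qed
    have X2: "prob X2 \<le> prob E2 * (real (length ps) * \<delta> + c)"
      unfolding X2_def
    proof (rule Cons.IH[OF E2 v ps])
      fix \<omega> assume "\<omega> \<in> E2"
      then have *: "accurate ?A (?w \<omega>)" "?w \<omega> < (1 + \<Delta>) * v \<omega>" "\<omega> \<in> E" by (auto simp: E2_def)
      show acc: "accurate A (v \<omega>) \<and> (1 + \<alpha>) * \<phi>_max \<le> (1 + \<Delta>) ^ Suc i * v \<omega>"
        by (rule Cons.prems(4)[OF *(3)])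
      fix x' y' assume xy': "x' \<in> A" "y' \<in> N - A" "(x', y') \<notin> set ps" "insert y' (A - {x'}) \<in> Ind"
      show "\<phi> (insert y' (A - {x'})) \<le> \<phi> A + swap_slack"
      proof (cases "(x', y') = p")
        case True
        then show ?thesis using rejected_swap[OF A(1) _ *(1,2)] acc p by simp
      next
        case False
        then show ?thesis using Cons.prems(5)[OF *(3)] xy' by auto
      qed
    qed
    have sets: "X1 \<in> sets S" "X2 \<in> sets S"
      unfolding X1_def X2_def
      using sets_Collect_subset[OF adapted_sets[OF E1] local_search_measurable[OF True adapted_var_measurable[OF w]]]
        sets_Collect_subset[OF adapted_sets[OF E2] resume_measurable[OF adapted_var_measurable[OF v]]] by auto
    have "{\<omega>\<in>E. \<not> ok (fst (resume \<omega> i A (v \<omega>) (p # ps) k))} \<subseteq> X \<union> X1 \<union> X2"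
      using True unfolding X_def X1_def X2_def E1_def E2_def
      by (auto simp: p resume_Cons Let_def split: if_splits)
    then have "prob {\<omega>\<in>E. \<not> ok (fst (resume \<omega> i A (v \<omega>) (p # ps) k))} \<le> prob (X \<union> X1 \<union> X2)"
      using X sets by (intro finite_measure_mono) auto
    also have "\<dots> \<le> prob X + prob X1 + prob X2"
      using measure_Un_le[of "X \<union> X1" S X2] measure_Un_le[of X S X1] X sets by auto
    also have "\<dots> \<le> prob E * \<delta> + (prob E1 + prob E2) * (real (length ps) * \<delta> + c)"
    proof -
      have "prob E1 * c \<le> prob E1 * (real (length ps) * \<delta> + c)"
        using \<delta>_pos by (intro mult_left_mono) auto
      then show ?thesis using X X1 X2 by (simp add: distrib_right)
    qed
    also have "\<dots> \<le> prob E * \<delta> + prob E * (real (length ps) * \<delta> + c)"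
    proof -
      \<comment> \<open>Disjointness keeps the cost linear in the number of calls: both branches
        carry the same bound, weighted by probabilities that add up to at most
        \<open>prob E\<close>.\<close>
      have "prob E1 + prob E2 = prob (E1 \<union> E2)"
        using adapted_sets[OF E1] adapted_sets[OF E2]
        by (intro finite_measure_Union[symmetric]) (auto simp: E1_def E2_def)
      also have "\<dots> \<le> prob E"
        using adapted_sets[OF E] by (intro finite_measure_mono) (auto simp: E1_def E2_def)
      finally show ?thesis using \<delta>_pos c by (intro add_left_mono mult_right_mono) auto
    qed
    finally show ?thesis by (simp add: algebra_simps)
  qed
qed

lemma local_search_fail_prob:
  assumes "A \<in> Ind" "card A = r" "adapted k E" "adapted_var k v"
    and "\<And>\<omega>. \<omega> \<in> E \<Longrightarrow> accurate A (v \<omega>) \<and> (1 + \<alpha>) * \<phi>_max \<le> (1 + \<Delta>) ^ i * v \<omega>"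
  shows "prob {\<omega>\<in>E. \<not> ok (fst (local_search F Ind \<Delta> pairs \<omega> i (A, v \<omega>, k)))}
    \<le> prob E * (real (i * r * n) * \<delta>)"
  using assms
proof (induction i arbitrary: A v k E)
  case 0
  have "ok A" if "\<omega> \<in> E" for \<omega>
  proof (rule \<phi>_maximal_ok)
    \<comment> \<open>No factor is left:
      \<open>(1 + \<alpha>) * \<phi>_max \<le> v \<omega>\<close>, and \<open>v \<omega>\<close>
      exceeds \<open>\<phi> A\<close> by at most \<open>\<alpha> * \<phi>_max\<close>.\<close>
    show "\<phi>_max \<le> \<phi> A"
      using 0(5)[OF that] unfolding accurate_def by (simp add: distrib_right) linarith
  qed (use 0 in auto)
  then have "{\<omega>\<in>E. \<not> ok (fst (local_search F Ind \<Delta> pairs \<omega> 0 (A, v \<omega>, k)))} = {}" by auto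
  then show ?case by (simp only: measure_empty)
next
  case (Suc i)
  have "prob {\<omega>\<in>E. \<not> ok (fst (resume \<omega> i A (v \<omega>) (pairs A) k))}
      \<le> prob E * (real (length (pairs A)) * \<delta> + real (i * r * n) * \<delta>)"
  proof (rule resume_fail_prob[OF Suc.prems(1,2) _ _ Suc.prems(3,4)])
    show "set (pairs A) \<subseteq> A \<times> (N - A)" using pairs_set Suc.prems by simp
    show "\<phi> (insert y (A - {x})) \<le> \<phi> A + swap_slack"
      if "x \<in> A" "y \<in> N - A" "(x, y) \<notin> set (pairs A)" for x y
      using that pairs_set Suc.prems by simp
  qed (use Suc.IH Suc.prems(5) \<delta>_pos in \<open>auto\<close>)
  also have "\<dots> \<le> prob E * (real (Suc i * r * n) * \<delta>)"
  proof (intro mult_left_mono)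
    have "real (length (pairs A)) * \<delta> \<le> real (r * n) * \<delta>"
      using length_pairs[OF Suc.prems(1)] \<delta>_pos by (intro mult_right_mono) (auto simp del: of_nat_mult)
    then show "real (length (pairs A)) * \<delta> + real (i * r * n) * \<delta> \<le> real (Suc i * r * n) * \<delta>"
      by (simp add: algebra_simps)
  qed simp
  finally show ?case by (simp only: local_search_Suc)
qed

section \<open>Choices of the greedy phase\<close>

abbreviation cand_val :: "(nat \<Rightarrow> 'c) \<Rightarrow> 'a set \<Rightarrow> nat \<Rightarrow> nat \<Rightarrow> real" where
  "cand_val \<omega> U k j \<equiv> F (insert (cand U ! j) U) (\<omega> (k + j))"

definition choice :: "(nat \<Rightarrow> 'c) \<Rightarrow> 'a set \<Rightarrow> nat \<Rightarrow> 'a" where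
  "choice \<omega> U k = tb U (maximizers (evaluations F \<omega> U k (cand U)))"

text \<open>Describing the maximizers by positions in \<open>es\<close> reduces them to finitely
  many comparisons of random variables.\<close>

lemma maximizers_evaluations:
  "maximizers (evaluations F \<omega> U k es) = (!) es `
     {j\<in>{..<length es}. \<forall>l\<in>{..<length es}. F (insert (es ! l) U) (\<omega> (k + l)) \<le> F (insert (es ! j) U) (\<omega> (k + j))}"
  (is "?L = ?R")
proof
  show "?L \<subseteq> ?R" unfolding maximizers_def evaluations_def by auto
  show "?R \<subseteq> ?L"
  proof
    fix e assume "e \<in> ?R"
    then obtain j where j: "j < length es" "e = es ! j"
      "\<forall>l<length es. F (insert (es ! l) U) (\<omega> (k + l)) \<le> F (insert (es ! j) U) (\<omega> (k + j))" by auto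
    then have "(e, F (insert (es ! j) U) (\<omega> (k + j))) \<in> set (evaluations F \<omega> U k es)"
      "\<forall>(e', v')\<in>set (evaluations F \<omega> U k es). v' \<le> F (insert (es ! j) U) (\<omega> (k + j))"
      unfolding evaluations_def by auto
    then show "e \<in> ?L" unfolding maximizers_def by blast
  qed
qed

lemma cand_insert:
  assumes "U \<in> Ind" "j < length (cand U)"
  shows "insert (cand U ! j) U \<in> Ind" "cand U ! j \<notin> U" "cand U ! j \<in> N"
  using nth_mem[OF assms(2)] cand_set[OF assms(1)] by auto

lemma choice_cases:
  assumes U: "U \<in> Ind" "card U < r"
  obtains j where "j < length (cand U)" "choice \<omega> U k = cand U ! j"
    "\<And>l. l < length (cand U) \<Longrightarrow> cand_val \<omega> U k l \<le> cand_val \<omega> U k j"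
proof -
  let ?m = "length (cand U)"
  let ?W = "{j\<in>{..<?m}. \<forall>l\<in>{..<?m}. cand_val \<omega> U k l \<le> cand_val \<omega> U k j}"
  have ne: "{..<?m} \<noteq> {}" using cand_nonempty[OF U] by auto
  then have "Max (cand_val \<omega> U k ` {..<?m}) \<in> cand_val \<omega> U k ` {..<?m}" by (intro Max_in) auto
  then obtain j where "j < ?m" "cand_val \<omega> U k j = Max (cand_val \<omega> U k ` {..<?m})" by auto
  then have "j \<in> ?W" by auto
  then have "(!) (cand U) ` ?W \<noteq> {}" by blast
  moreover have "(!) (cand U) ` ?W \<subseteq> N" using cand_insert[OF U(1)] by auto
  ultimately have "choice \<omega> U k \<in> (!) (cand U) ` ?W"
    unfolding choice_def maximizers_evaluations by (intro tb_in[OF U(1)])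
  then obtain j where "j \<in> ?W" "choice \<omega> U k = cand U ! j" by blast
  then show thesis using that[of j] by simp
qed

lemma greedy_step_choice:
  assumes "U \<in> Ind" "j < length (cand U)" "choice \<omega> U k = cand U ! j"
  shows "greedy_step F cand tb \<omega> (U, v, k)
    = (insert (cand U ! j) U, cand_val \<omega> U k j, k + length (cand U))"
proof -
  let ?evs = "evaluations F \<omega> U k (cand U)"
  have "map fst ?evs = cand U"
    unfolding evaluations_def by (simp add: o_def map_nth)
  \<comment> \<open>Distinct candidates ensure that \<open>map_of\<close> finds the value of this
    very call.\<close>
  then have "distinct (map fst ?evs)" using cand_distinct[OF assms(1)] by simp
  moreover have "(cand U ! j, cand_val \<omega> U k j) \<in> set ?evs"
    using assms(2) unfolding evaluations_def by auto
  ultimately have "map_of ?evs (cand U ! j) = Some (cand_val \<omega> U k j)"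
    by (simp add: map_of_eq_Some_iff)
  moreover have "length ?evs = length (cand U)" by (simp add: evaluations_def)
  ultimately show ?thesis using assms(3) by (simp add: choice_def Let_def)
qed

text \<open>\<open>tb\<close> is an arbitrary rule, so the event is split by the set
  \<open>J\<close> of maximizing positions: there are finitely many, and each occurs on a finite
  Boolean combination of comparisons.\<close>

lemma choice_measurable:
  assumes U: "U \<in> Ind"
  shows "{\<omega>\<in>space S. choice \<omega> U k = e} \<in> sets S"
proof -
  let ?m = "length (cand U)"
  let ?J = "{J. J \<subseteq> {..<?m} \<and> tb U ((!) (cand U) ` J) = e}"
  let ?best = "\<lambda>\<omega> j. \<forall>l\<in>{..<?m}. cand_val \<omega> U k l \<le> cand_val \<omega> U k j"
  have best: "{\<omega>\<in>space S. ?best \<omega> j} \<in> sets S" if "j < ?m" for j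
    using that cand_insert[OF U]
    by (intro sets.sets_Collect_finite_All borel_measurable_le F_component_measurable) auto
  have "{\<omega>\<in>space S. \<forall>j\<in>{..<?m}. j \<in> J \<longleftrightarrow> ?best \<omega> j} \<in> sets S" for J
  proof (rule sets.sets_Collect_finite_All)
    fix j assume "j \<in> {..<?m}"
    then show "{\<omega>\<in>space S. j \<in> J \<longleftrightarrow> ?best \<omega> j} \<in> sets S"
      using best[of j] sets.sets_Collect_neg[OF best[of j]] by (cases "j \<in> J") auto
  qed simp
  then have "(\<Union>J\<in>?J. {\<omega>\<in>space S. \<forall>j\<in>{..<?m}. j \<in> J \<longleftrightarrow> ?best \<omega> j}) \<in> sets S"
    by (intro sets.finite_UN) auto
  also have "(\<Union>J\<in>?J. {\<omega>\<in>space S. \<forall>j\<in>{..<?m}. j \<in> J \<longleftrightarrow> ?best \<omega> j})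
      = {\<omega>\<in>space S. choice \<omega> U k = e}" (is "?L = ?R")
  proof
    show "?L \<subseteq> ?R"
    proof
      fix \<omega> assume "\<omega> \<in> ?L"
      then obtain J where \<omega>: "\<omega> \<in> space S" and J: "J \<subseteq> {..<?m}" "tb U ((!) (cand U) ` J) = e"
        "\<forall>j\<in>{..<?m}. j \<in> J \<longleftrightarrow> ?best \<omega> j" by blast
      then have "{j\<in>{..<?m}. ?best \<omega> j} = J" by blast
      then show "\<omega> \<in> ?R"
        unfolding choice_def maximizers_evaluations using \<omega> J(2) by simp
    qed
    show "?R \<subseteq> ?L"
    proof
      fix \<omega> assume "\<omega> \<in> ?R"
      then show "\<omega> \<in> ?L"
        unfolding choice_def maximizers_evaluations
        by (intro UN_I[of "{j\<in>{..<?m}. ?best \<omega> j}"]) auto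
    qed
  qed
  finally show ?thesis .
qed

section \<open>The whole run and its failure probability\<close>

text \<open>The remaining \<open>i\<close> greedy steps followed by the local search, so that an
  induction on \<open>i\<close> peels off the earliest step.\<close>

definition run :: "(nat \<Rightarrow> 'c) \<Rightarrow> nat \<Rightarrow> 'a set \<times> real \<times> nat \<Rightarrow> 'a set \<times> nat" where
  "run \<omega> i st = local_search F Ind \<Delta> pairs \<omega> K ((greedy_step F cand tb \<omega> ^^ i) st)"

lemma run_0: "run \<omega> 0 st = local_search F Ind \<Delta> pairs \<omega> K st"
  by (simp add: run_def)

lemma run_Suc: "run \<omega> (Suc i) st = run \<omega> i (greedy_step F cand tb \<omega> st)"
  by (simp add: run_def funpow_swap1)

lemma nls_eq_run: "nls F Ind \<Delta> \<alpha> cand tb pairs \<omega> = run \<omega> r ({}, 0, 0)"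
  by (simp add: nls_def greedy_phase_def run_def)

lemma run_measurable:
  assumes "U \<in> Ind" "card U + i = r" "v \<in> borel_measurable S"
  shows "{\<omega>\<in>space S. Q (fst (run \<omega> i (U, v \<omega>, k)))} \<in> sets S"
  using assms
proof (induction i arbitrary: U v k)
  case 0
  then show ?case unfolding run_0 by (intro local_search_measurable)
next
  case (Suc i)
  let ?m = "length (cand U)"
  let ?next = "\<lambda>\<omega> j. (insert (cand U ! j) U, cand_val \<omega> U k j, k + ?m)"
  have "{\<omega>\<in>space S. Q (fst (run \<omega> i (?next \<omega> j)))} \<in> sets S" if "j < ?m" for j
    using that cand_insert[OF Suc.prems(1)] Suc.prems Ind_finite
    by (intro Suc.IH F_component_measurable) auto
  then have "(\<Union>j\<in>{..<?m}. {\<omega>\<in>space S. choice \<omega> U k = cand U ! j}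
      \<inter> {\<omega>\<in>space S. Q (fst (run \<omega> i (?next \<omega> j)))}) \<in> sets S"
    using choice_measurable[OF Suc.prems(1)] by (intro sets.finite_UN sets.Int) auto
  also have "(\<Union>j\<in>{..<?m}. {\<omega>\<in>space S. choice \<omega> U k = cand U ! j}
      \<inter> {\<omega>\<in>space S. Q (fst (run \<omega> i (?next \<omega> j)))})
      = {\<omega>\<in>space S. Q (fst (run \<omega> (Suc i) (U, v \<omega>, k)))}" (is "?L = ?R")
  proof
    show "?L \<subseteq> ?R"
      using greedy_step_choice[OF Suc.prems(1)] by (auto simp: run_Suc)
    show "?R \<subseteq> ?L"
    proof
      fix \<omega> assume \<omega>: "\<omega> \<in> ?R"
      obtain j where "j < ?m" "choice \<omega> U k = cand U ! j"
        using choice_cases[OF Suc.prems(1), of \<omega> k] Suc.prems(2) by auto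
      then show "\<omega> \<in> ?L"
        using \<omega> greedy_step_choice[OF Suc.prems(1)] by (auto simp: run_Suc)
    qed
  qed
  finally show ?case .
qed

lemma choice_cong:
  assumes "\<forall>j<k + length (cand U). \<omega> j = \<omega>' j"
  shows "choice \<omega> U k = choice \<omega>' U k"
proof -
  have "evaluations F \<omega> U k (cand U) = evaluations F \<omega>' U k (cand U)"
    using assms unfolding evaluations_def by auto
  then show ?thesis by (simp add: choice_def)
qed

text \<open>All candidates of \<open>U\<close> are known before they are evaluated, so their calls
  obey a plain union bound within \<open>E\<close>. If all are accurate, the chosen position splits
  \<open>E\<close> into disjoint events, each with a fixed next set. Accuracy of \<open>v\<close> is
  demanded for \<open>i = 0\<close> only: a greedy step does not read it, and the initial value is a
  dummy.\<close>

lemma run_fail_prob: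
  assumes "U \<in> Ind" "card U + i = r" "greedy_inv U" "adapted k E" "adapted_var k v"
    and "\<And>\<omega>. i = 0 \<Longrightarrow> \<omega> \<in> E \<Longrightarrow> accurate U (v \<omega>)"
  shows "prob {\<omega>\<in>E. \<not> ok (fst (run \<omega> i (U, v \<omega>, k)))} \<le> prob E * (real (i * n + K * r * n) * \<delta>)"
  using assms
proof (induction i arbitrary: U v k E)
  case 0
  have "prob {\<omega>\<in>E. \<not> ok (fst (local_search F Ind \<Delta> pairs \<omega> K (U, v \<omega>, k)))}
    \<le> prob E * (real (K * r * n) * \<delta>)"
  proof (rule local_search_fail_prob[OF 0(1) _ 0(4,5)])
    fix \<omega> assume "\<omega> \<in> E"
    then have "accurate U (v \<omega>)" using 0(6) by blast
    then show "accurate U (v \<omega>) \<and> (1 + \<alpha>) * \<phi>_max \<le> (1 + \<Delta>) ^ K * v \<omega>"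
      using greedy_value_iterated[OF 0(1) _ 0(3)] 0(2) by simp
  qed (use 0 in simp)
  then show ?case by (simp add: run_0)
next
  case (Suc i)
  note U = Suc.prems(1)
  let ?m = "length (cand U)"
  let ?U = "\<lambda>j. insert (cand U ! j) U"
  let ?c = "real (i * n + K * r * n) * \<delta>"
  note E = Suc.prems(4)
  define X where "X j = {\<omega>\<in>E. \<not> accurate (?U j) (cand_val \<omega> U k j)}" for j
  define good where "good \<omega> \<longleftrightarrow> (\<forall>l\<in>{..<?m}. accurate (?U l) (cand_val \<omega> U k l))" for \<omega>
  define E' where "E' j = {\<omega>\<in>E. good \<omega> \<and> choice \<omega> U k = cand U ! j}" for j
  define Y where "Y j = {\<omega>\<in>E' j. \<not> ok (fst (run \<omega> i (?U j, cand_val \<omega> U k j, k + ?m)))}" for j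
  have UI: "?U j \<in> Ind" "card (?U j) + i = r" if "j < ?m" for j
    using cand_insert[OF U that] Suc.prems(2) Ind_finite[OF U] by auto
  have val: "adapted_var (k + ?m) (\<lambda>\<omega>. cand_val \<omega> U k j)" if "j < ?m" for j
    using that UI Ind_subset by (intro adapted_var_component F_measurable) auto
  have X: "X j \<in> sets S" "prob (X j) \<le> prob E * \<delta>" if "j < ?m" for j
    unfolding X_def using prob_inaccurate[OF adapted_mono[OF E] UI(1)[OF that], of "k + j"] by auto
  have E': "adapted (k + ?m) (E' j)" for j
    unfolding E'_def
  proof (rule adapted_Collect)
    show "adapted (k + ?m) E" using adapted_mono[OF E] by simp
    have "{\<omega>\<in>space S. good \<omega>} \<in> sets S"
      unfolding good_def accurate_def using UI(1)
      by (intro sets.sets_Collect_finite_All borel_measurable_le borel_measurable_abs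
          borel_measurable_diff borel_measurable_const F_component_measurable) auto
    then show "Measurable.pred S (\<lambda>\<omega>. good \<omega> \<and> choice \<omega> U k = cand U ! j)"
      unfolding pred_def using choice_measurable[OF U] by (intro sets.sets_Collect_conj) auto
    fix \<omega> \<omega>' :: "nat \<Rightarrow> 'c" assume eq: "\<forall>j<k + ?m. \<omega> j = \<omega>' j"
    then have "good \<omega> = good \<omega>'" unfolding good_def by auto
    then show "(good \<omega> \<and> choice \<omega> U k = cand U ! j) = (good \<omega>' \<and> choice \<omega>' U k = cand U ! j)"
      using choice_cong[OF eq] by simp
  qed
  have Y: "Y j \<in> sets S" "prob (Y j) \<le> prob (E' j) * ?c" if j: "j < ?m" for j
  proof -
    show "Y j \<in> sets S"
      unfolding Y_def
      by (rule sets_Collect_subset[OF adapted_sets[OF E'] run_measurable[OF UI[OF j] adapted_var_measurable[OF val[OF j]]]])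
    show "prob (Y j) \<le> prob (E' j) * ?c"
    \<comment> \<open>\<open>greedy_inv (?U j)\<close> speaks of a fixed set, so a single outcome in
      \<open>E' j\<close> suffices to prove it; an empty \<open>E' j\<close> contributes no
      failure.\<close>
    proof (cases "E' j = {}")
      case True
      then have "Y j = {}" by (auto simp: Y_def)
      then show ?thesis using True by simp
    next
      case False
      then obtain \<omega> where \<omega>: "good \<omega>" "choice \<omega> U k = cand U ! j" by (auto simp: E'_def)
      have best: "cand_val \<omega> U k l \<le> cand_val \<omega> U k j" if "l < ?m" for l
      proof -
        obtain j' where j': "j' < ?m" "choice \<omega> U k = cand U ! j'"
            "\<And>l. l < ?m \<Longrightarrow> cand_val \<omega> U k l \<le> cand_val \<omega> U k j'"
          using choice_cases[OF U, of \<omega> k] Suc.prems(2) by auto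
        then have "j' = j"
          using \<omega>(2) j nth_eq_iff_index_eq[OF cand_distinct[OF U]] by metis
        then show ?thesis using j'(3) that by blast
      qed
      have "greedy_inv (?U j)"
      proof (rule greedy_inv_insert[OF U Suc.prems(3)])
        fix e assume "e \<in> N - U" "insert e U \<in> Ind"
        then have "e \<in> set (cand U)" using cand_set[OF U] by auto
        then obtain l where l: "l < ?m" "e = cand U ! l" by (auto simp: in_set_conv_nth)
        have "accurate (?U l) (cand_val \<omega> U k l)" "accurate (?U j) (cand_val \<omega> U k j)"
          using \<omega>(1) l j unfolding good_def by auto
        then show "\<phi> (insert e U) \<le> \<phi> (?U j) + 2 * \<alpha> * \<phi>_max"
          using best[OF l(1)] l(2) unfolding accurate_def by (simp add: abs_le_iff)
      qed (use cand_insert[OF U j] in auto)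
      then show ?thesis
        unfolding Y_def
      proof (intro Suc.IH[OF UI[OF j] _ E' val[OF j]])
        fix \<omega> assume "\<omega> \<in> E' j"
        then show "accurate (?U j) (cand_val \<omega> U k j)" using j by (auto simp: E'_def good_def)
      qed
    qed
  qed
  have sum_E': "(\<Sum>j<?m. prob (E' j)) \<le> prob E"
  proof -
    have "disjoint_family_on E' {..<?m}"
      unfolding disjoint_family_on_def E'_def
      using nth_eq_iff_index_eq[OF cand_distinct[OF U]] by auto
    then have "(\<Sum>j<?m. prob (E' j)) = prob (\<Union>j\<in>{..<?m}. E' j)"
      using adapted_sets[OF E'] by (intro finite_measure_finite_Union[symmetric]) auto
    also have "\<dots> \<le> prob E"
      using adapted_sets[OF E] by (intro finite_measure_mono) (auto simp: E'_def)
    finally show ?thesis .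
  qed
  have "{\<omega>\<in>E. \<not> ok (fst (run \<omega> (Suc i) (U, v \<omega>, k)))} \<subseteq> (\<Union>j\<in>{..<?m}. X j) \<union> (\<Union>j\<in>{..<?m}. Y j)"
  proof
    fix \<omega> assume \<omega>: "\<omega> \<in> {\<omega>\<in>E. \<not> ok (fst (run \<omega> (Suc i) (U, v \<omega>, k)))}"
    obtain j where j: "j < ?m" "choice \<omega> U k = cand U ! j"
      using choice_cases[OF U, of \<omega> k] Suc.prems(2) by auto
    show "\<omega> \<in> (\<Union>j\<in>{..<?m}. X j) \<union> (\<Union>j\<in>{..<?m}. Y j)"
    proof (cases "good \<omega>")
      case True
      then have "\<omega> \<in> Y j"
        using \<omega> j greedy_step_choice[OF U j] by (auto simp: Y_def E'_def run_Suc)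
      then show ?thesis using j by auto
    next
      case False
      then show ?thesis using \<omega> by (auto simp: good_def X_def)
    qed
  qed
  then have "prob {\<omega>\<in>E. \<not> ok (fst (run \<omega> (Suc i) (U, v \<omega>, k)))}
      \<le> prob ((\<Union>j\<in>{..<?m}. X j) \<union> (\<Union>j\<in>{..<?m}. Y j))"
    using X Y by (intro finite_measure_mono sets.Un sets.finite_UN) auto
  also have "\<dots> \<le> prob (\<Union>j\<in>{..<?m}. X j) + prob (\<Union>j\<in>{..<?m}. Y j)"
    using X Y by (intro measure_Un_le sets.finite_UN) auto
  also have "\<dots> \<le> (\<Sum>j<?m. prob (X j)) + (\<Sum>j<?m. prob (Y j))"
    using X Y by (intro add_mono measure_UNION_le) auto
  also have "\<dots> \<le> (\<Sum>j<?m. prob E * \<delta>) + (\<Sum>j<?m. prob (E' j) * ?c)"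
    using X Y by (intro add_mono sum_mono) auto
  also have "\<dots> = prob E * (real ?m * \<delta>) + (\<Sum>j<?m. prob (E' j)) * ?c"
    by (simp add: sum_distrib_right)
  also have "\<dots> \<le> prob E * (real n * \<delta>) + prob E * ?c"
    using length_cand[OF U] sum_E' \<delta>_pos
    by (intro add_mono mult_left_mono mult_right_mono) auto
  also have "\<dots> = prob E * (real (Suc i * n + K * r * n) * \<delta>)"
    by (simp add: algebra_simps)
  finally show ?case .
qed

section \<open>Number of calls\<close>

text \<open>Holds on every run, accurate or not: a scan makes at most one call per pair, and there
  are at most \<open>r * n\<close> pairs.\<close>

lemma local_search_calls:
  assumes "A \<in> Ind" "card A = r"
  shows "snd (local_search F Ind \<Delta> pairs \<omega> i (A, v, k)) \<le> k + i * (r * n)"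
  using assms
proof (induction i arbitrary: A v k)
  case (Suc i)
  have "set ps \<subseteq> A \<times> (N - A) \<Longrightarrow> snd (resume \<omega> i A v ps k) \<le> k + length ps + i * (r * n)" for ps k
  proof (induction ps arbitrary: k)
    case (Cons p ps)
    obtain x y where p: "p = (x, y)" by (cases p)
    let ?A = "insert y (A - {x})"
    have ps: "set ps \<subseteq> A \<times> (N - A)" using Cons.prems by simp
    have "card ?A = r" using card_swap[OF Suc.prems(1), of x y] Suc.prems(2) Cons.prems p by auto
    then show ?case
      using Suc.IH[of ?A "F ?A (\<omega> k)" "Suc k"] Cons.IH[OF ps, of k] Cons.IH[OF ps, of "Suc k"]
      by (auto simp: p resume_Cons Let_def)
  qed (simp add: resume_Nil)
  from this[of "pairs A" k] show ?case
    unfolding local_search_Suc using length_pairs[OF Suc.prems(1)] pairs_set[OF Suc.prems(1)] by simp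
qed simp

lemma run_calls:
  assumes "U \<in> Ind" "card U + i = r"
  shows "snd (run \<omega> i (U, v, k)) \<le> k + i * n + K * (r * n)"
  using assms
proof (induction i arbitrary: U v k)
  case 0
  then show ?case using local_search_calls[of U \<omega> K v k] by (simp add: run_0)
next
  case (Suc i)
  obtain j where j: "j < length (cand U)" "choice \<omega> U k = cand U ! j"
    using choice_cases[OF Suc.prems(1), of \<omega> k] Suc.prems(2) by auto
  have "snd (run \<omega> i (insert (cand U ! j) U, cand_val \<omega> U k j, k + length (cand U)))
      \<le> k + length (cand U) + i * n + K * (r * n)"
    using cand_insert[OF Suc.prems(1) j(1)] Ind_finite[OF Suc.prems(1)] Suc.prems(2)
    by (intro Suc.IH) auto
  then show ?case
    using length_cand[OF Suc.prems(1)] greedy_step_choice[OF Suc.prems(1) j] by (simp add: run_Suc)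
qed

lemma nls_calls_le: "nls_calls F Ind \<Delta> \<alpha> cand tb pairs \<omega> \<le> (K + 1) * r * n"
  unfolding nls_eq_run using run_calls[of "{}" r \<omega> 0 0] empty_Ind by (simp add: algebra_simps)

lemma nls_output_measurable:
  "{\<omega>\<in>space S. Q (nls_output F Ind \<Delta> \<alpha> cand tb pairs \<omega>)} \<in> sets S"
  unfolding nls_eq_run using run_measurable[of "{}" r "\<lambda>_. 0" Q 0] empty_Ind by simp

lemma nls_ok_prob:
  "prob {\<omega>\<in>space S. ok (nls_output F Ind \<Delta> \<alpha> cand tb pairs \<omega>)} \<ge> 1 - real (K + 1) * real r * real n * \<delta>"
proof -
  have "prob {\<omega>\<in>space S. \<not> ok (fst (run \<omega> r ({}, 0, 0)))}
      \<le> prob (space S) * (real (r * n + K * r * n) * \<delta>)"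
    \<comment> \<open>The starting value is the dummy 0; the premise on its accuracy is vacuous
      because \<open>1 \<le> r\<close>.\<close>
    using run_fail_prob[of "{}" r 0 "space S" "\<lambda>_. 0"] empty_Ind greedy_inv_empty adapted_space rank_ge
    by (auto simp: adapted_var_def)
  moreover have "{\<omega>\<in>space S. \<not> ok (fst (run \<omega> r ({}, 0, 0)))}
      = space S - {\<omega>\<in>space S. ok (fst (run \<omega> r ({}, 0, 0)))}" by auto
  moreover have "{\<omega>\<in>space S. ok (fst (run \<omega> r ({}, 0, 0)))} \<in> sets S"
    using nls_output_measurable[of ok] unfolding nls_eq_run .
  ultimately show ?thesis
    unfolding nls_eq_run by (simp add: P.prob_compl P.prob_space algebra_simps)
qed

end

text \<open>The measure is an infinite product, one seed per possible call, since the number of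
  calls differs from run to run. \<open>I\<close> is rounded up as it counts iterations, and
  positivity of \<open>1 - 2 * (r + 1) * \<alpha>\<close> gives the logarithm a positive
  argument.\<close>

theorem theorem3p3:
  fixes N :: "'a set" and Ind :: "'a set set" and h :: "'a set \<Rightarrow> real"
    and R :: "'c measure" and F :: "'a set \<Rightarrow> 'c \<Rightarrow> real"
    and n r :: nat and \<alpha> \<delta> \<Delta> I :: real
    and cand :: "'a set \<Rightarrow> 'a list" and tb :: "'a set \<Rightarrow> 'a set \<Rightarrow> 'a"
    and pairs :: "'a set \<Rightarrow> ('a \<times> 'a) list"
  assumes "finite N" and "card N = n"
    and "\<forall>S\<subseteq>N. 0 \<le> h S" and "monotone_set_fun N h" and "submodular_set_fun N h"
    and "matroid N Ind" and "matroid_rank Ind = r" and "1 \<le> r"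
    and "0 < \<alpha>" and "0 < \<delta>" and "0 < \<Delta>" and "\<Delta> < 1 / 2"
    and "0 < 1 - 2 * (real r + 1) * \<alpha>"
    and "randomized_fun N R F"
    and "approximation_of \<alpha> \<delta> Ind R F (aux_fun h)"
    and "nls_rules N Ind cand tb pairs"
    and "I = real_of_int \<lceil>log (1 + \<Delta>) (2 * (1 + \<alpha>) / (1 - 2 * (real r + 1) * \<alpha>))\<rceil>"
  shows "measure (PiM (UNIV :: nat set) (\<lambda>_. R))
           {\<omega> \<in> space (PiM (UNIV :: nat set) (\<lambda>_. R)).
              h (nls_output F Ind \<Delta> \<alpha> cand tb pairs \<omega>)
                \<ge> (1 - 1 / exp 1)
                    * (1 - real r * ln (exp 1 * real r) * ((2 + \<Delta>) * \<alpha> + \<Delta>))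
                    * Max (h ` Ind)}
           \<ge> 1 - (I + 1) * real r * real n * \<delta>
         \<and> (\<forall>\<omega> \<in> space (PiM (UNIV :: nat set) (\<lambda>_. R)).
              real (nls_calls F Ind \<Delta> \<alpha> cand tb pairs \<omega>) \<le> (I + 1) * real r * real n)"
proof -
  define g where "g = h({} := 0)"
  have h0: "0 \<le> h {}" using assms(3) by simp
  have g_le: "g A \<le> h A" for A using h0 by (simp add: g_def)
  have h_le: "h A \<le> h B" if "A \<subseteq> B" "B \<subseteq> N" for A B
    using assms(4) that unfolding monotone_set_fun_def by blast
  have mono: "monotone_set_fun N g"
    unfolding monotone_set_fun_def g_def using h_le assms(3) by auto
  have submod: "submodular_set_fun N g"
    unfolding submodular_set_fun_def
  proof (intro allI impI)
    fix A B x assume a: "A \<subseteq> B \<and> B \<subseteq> N \<and> x \<in> N - B"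
    then have "h (insert x B) - h B \<le> h (insert x A) - h A"
      using assms(5) unfolding submodular_set_fun_def by blast
    then show "g (insert x B) - g B \<le> g (insert x A) - g A"
      \<comment> \<open>The reset can only raise a marginal at the empty set, and
        \<open>A \<subseteq> B\<close> puts such a marginal on the larger side or on both.\<close>
      using a h0 by (auto simp: g_def)
  qed
  have aux: "aux_fun g = aux_fun h"
    unfolding aux_fun_def g_def by (intro ext sum.cong) auto
  have prob: "prob_space R" using assms(14) by (simp add: randomized_fun_def)
  interpret prob_space R by (rule prob)
  interpret noisy_search N g Ind R F \<alpha> \<delta> \<Delta> cand tb pairs
  proof unfold_locales
    show "g {} = 0" by (simp add: g_def)
  qed (use assms mono submod in \<open>auto simp: aux randomized_fun_def\<close>)
  have max_eq: "Max (g ` Ind) = Max (h ` Ind)"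
  proof (rule antisym)
    show "Max (g ` Ind) \<le> Max (h ` Ind)"
      using finite_Ind empty_Ind g_le by (subst Max_le_iff) (auto intro: order_trans[OF g_le Max_ge])
    obtain B where B: "B \<in> Ind" "card B = matroid_rank Ind" using ex_basis by auto
    \<comment> \<open>Prepares the case of \<open>h {}\<close>, the one value lowered by the reset:
      a nonempty basis has at least this value, and there \<open>g\<close> agrees with
      \<open>h\<close>.\<close>
    then have "B \<noteq> {}" using rank_ge by auto
    have "h A \<le> Max (g ` Ind)" if A: "A \<in> Ind" for A
    proof (cases "A = {}")
      case True
      then have "h A \<le> g B" using h_le[of A B] B(1) Ind_subset \<open>B \<noteq> {}\<close> by (simp add: g_def)
      also have "\<dots> \<le> Max (g ` Ind)" using h_le_max B(1) .
      finally show ?thesis .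
    next
      case False
      then show ?thesis using h_le_max[OF A] by (simp add: g_def)
    qed
    then show "Max (h ` Ind) \<le> Max (g ` Ind)"
      using finite_Ind empty_Ind by (subst Max_le_iff) auto
  qed
  let ?out = "nls_output F Ind \<Delta> \<alpha> cand tb pairs"
  let ?P = "\<lambda>A. h A \<ge> (1 - 1 / exp 1)
    * (1 - real r * ln (exp 1 * real r) * ((2 + \<Delta>) * \<alpha> + \<Delta>)) * Max (h ` Ind)"
  have I: "I = real (nls_iterations \<alpha> \<Delta> r)"
  proof -
    \<comment> \<open>A ratio of at least 1 makes the logarithm nonnegative, so the conversion to
      \<open>nat\<close> loses nothing.\<close>
    have "1 \<le> 2 * (1 + \<alpha>) / (1 - 2 * (real r + 1) * \<alpha>)"
      using assms(9,13) by (simp add: field_simps)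
    then have "0 \<le> log (1 + \<Delta>) (2 * (1 + \<alpha>) / (1 - 2 * (real r + 1) * \<alpha>))"
      using assms(11) by (subst zero_le_log_cancel_iff) auto
    then show ?thesis unfolding assms(17) nls_iterations_def by simp
  qed
  have "1 - (I + 1) * real r * real n * \<delta>
      \<le> measure (PiM UNIV (\<lambda>_. R)) {\<omega>\<in>space (PiM UNIV (\<lambda>_. R)). ok (?out \<omega>)}"
    using nls_ok_prob unfolding I assms(2) assms(7) by (simp add: add.commute)
  \<comment> \<open>In this context \<open>ok\<close> is the guarantee for \<open>g\<close>; it
    passes to \<open>h\<close> because \<open>g\<close> is below \<open>h\<close> and the maxima
    agree.\<close>
  also have "\<dots> \<le> measure (PiM UNIV (\<lambda>_. R)) {\<omega>\<in>space (PiM UNIV (\<lambda>_. R)). ?P (?out \<omega>)}"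
  proof (rule finite_measure_mono)
    show "{\<omega>\<in>space (PiM UNIV (\<lambda>_. R)). ok (?out \<omega>)}
        \<subseteq> {\<omega>\<in>space (PiM UNIV (\<lambda>_. R)). ?P (?out \<omega>)}"
      unfolding ok_def max_eq assms(7) using g_le order_trans by blast
    show "{\<omega>\<in>space (PiM UNIV (\<lambda>_. R)). ?P (?out \<omega>)} \<in> sets (PiM UNIV (\<lambda>_. R))"
      by (rule nls_output_measurable)
  qed
  finally have "1 - (I + 1) * real r * real n * \<delta>
      \<le> measure (PiM UNIV (\<lambda>_. R)) {\<omega>\<in>space (PiM UNIV (\<lambda>_. R)). ?P (?out \<omega>)}" .
  moreover have "real (nls_calls F Ind \<Delta> \<alpha> cand tb pairs \<omega>) \<le> (I + 1) * real r * real n" for \<omega>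
  proof -
    have "real (nls_calls F Ind \<Delta> \<alpha> cand tb pairs \<omega>) \<le> real ((nls_iterations \<alpha> \<Delta> r + 1) * r * n)"
      using nls_calls_le[of \<omega>] unfolding assms(2) assms(7) of_nat_le_iff .
    then show ?thesis unfolding I by (simp add: algebra_simps)
  qed
  ultimately show ?thesis by blast
qed

end
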